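(* Let $M$ be a compact manifold of dimension $N$, let $0<\rho\le1$, let $f:M\to M$ be a $C^{1+\rho}$ diffeomorphism that has only hyperbolic periodic points, and let $M_{1+\rho}=\max(\|f\|_{C^{1+\rho}},2^{1/\rho})$. Then there is a constant $C=C(M)>0$, depending only on $M$, such that for each integer $n\ge1$ $$P_n(f)\le C\,(M_{1+\rho})^{nN(1+\rho)/\rho}\,\gamma_n(f)^{-N/\rho}.$$
   Context: $M$ is a smooth compact manifold, regarded as a fixed smooth submanifold of some Euclidean space $\mathbb R^d$; tangent spaces carry the induced Euclidean norm. $\|f\|_{C^{1+\rho}}$ is the $C^{1+\rho}$ norm: the maximum of $\sup_x|f(x)|$, $\sup_x\|df(x)\|$, and the $\rho$-Hölder constant of the derivative, the latter viewed as the matrix-valued map $x\mapsto df(x)\circ\Pi_x$ where $\Pi_x:\mathbb R^d\to T_xM$ is the orthogonal projection. $P_n(f)=\#\{x\in M:f^n(x)=x\}$. A point $x$ with $f^n(x)=x$ is hyperbolic if $df^n(x)$ has no eigenvalues of modulus $1$. For a linear operator $L$ on an $N$-dimensional Euclidean space (extended to the complexification, with its Hermitian norm $|\cdot|$) the hyperbolicity is $$\gamma(L)=\inf_{\phi\in[0,1)}\ \inf_{|v|=1}|Lv-e^{2\pi i\phi}v|.$$ Put $\gamma_n(x,f)=\gamma(df^n(x))$ for $x=f^n(x)$ and $\gamma_n(f)=\min_{\{x:\,f^n(x)=x\}}\gamma_n(x,f)$ (equal to $+\infty$ if there are no such $x$, in which case $\gamma_n(f)^{-N/\rho}=0$). 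*)

theory Defs
  imports "HOL-Analysis.Analysis"
begin

section \<open>Smooth submanifolds of Euclidean space\<close>

text \<open>\<open>Ck_on k S f\<close>: \<open>f\<close> is of class \<open>C^k\<close> on \<open>S\<close>. Intended for open \<open>S\<close> only.\<close>

primrec Ck_on ::
  "nat \<Rightarrow> 'a::euclidean_space set \<Rightarrow> ('a \<Rightarrow> 'b::euclidean_space) \<Rightarrow> bool" where
  "Ck_on 0 S f \<longleftrightarrow> continuous_on S f"
| "Ck_on (Suc k) S f \<longleftrightarrow>
     f differentiable_on S \<and> (\<forall>v. Ck_on k S (\<lambda>x. frechet_derivative f (at x) v))"

definition smooth_on ::
  "'a::euclidean_space set \<Rightarrow> ('a \<Rightarrow> 'b::euclidean_space) \<Rightarrow> bool" where
  "smooth_on S f \<longleftrightarrow> (\<forall>k. Ck_on k S f)"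

text \<open>Every point has an ambient smooth slice chart onto an open piece of an
  \<open>N\<close>-dimensional linear subspace (no boundary).\<close>

definition smooth_submanifold :: "nat \<Rightarrow> 'a::euclidean_space set \<Rightarrow> bool" where
  "smooth_submanifold N M \<longleftrightarrow>
     (\<forall>p\<in>M. \<exists>U V \<phi> \<psi> S. open U \<and> p \<in> U \<and> open V \<and> homeomorphism U V \<phi> \<psi> \<and>
        smooth_on U \<phi> \<and> smooth_on V \<psi> \<and>
        subspace (S :: 'a set) \<and> dim S = N \<and> \<phi> ` (U \<inter> M) = V \<inter> S)"

text \<open>Velocities of curves in \<open>M\<close>. On a submanifold, curves that are merely differentiable
  at time \<open>0\<close> have the same velocities as smooth ones.\<close>

definition tangent_space :: "'a::euclidean_space set \<Rightarrow> 'a \<Rightarrow> 'a set" where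
  "tangent_space M x =
     {v. \<exists>(c :: real \<Rightarrow> 'a) e. e > 0 \<and> (\<forall>t. \<bar>t\<bar> < e \<longrightarrow> c t \<in> M) \<and> c 0 = x \<and>
         (c has_vector_derivative v) (at 0)}"

definition orth_proj :: "'a::euclidean_space set \<Rightarrow> 'a \<Rightarrow> 'a" where
  "orth_proj T v = (THE p. p \<in> T \<and> (\<forall>w\<in>T. orthogonal (v - p) w))"


section \<open>Maps of class \<open>C^(1+\<rho>)\<close>\<close>

text \<open>\<open>mderiv M f x\<close> is \<open>df(x) \<circ> \<Pi>_x\<close>; its restriction to the tangent space is \<open>df(x)\<close>.
  A derivative of \<open>f\<close> at \<open>x\<close> within \<open>M\<close> is not unique on the ambient space, but on a
  submanifold it is unique on the tangent space, so the composition with the projection does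
  not depend on the one that \<open>frechet_derivative\<close> chooses.\<close>

definition mderiv :: "'a::euclidean_space set \<Rightarrow> ('a \<Rightarrow> 'a) \<Rightarrow> 'a \<Rightarrow> 'a \<Rightarrow> 'a" where
  "mderiv M f x = frechet_derivative f (at x within M) \<circ> orth_proj (tangent_space M x)"

definition C1_Holder :: "real \<Rightarrow> 'a::euclidean_space set \<Rightarrow> ('a \<Rightarrow> 'a) \<Rightarrow> bool" where
  "C1_Holder \<rho> M f \<longleftrightarrow> f differentiable_on M \<and>
     (\<exists>K. \<forall>x\<in>M. \<forall>y\<in>M. onorm (\<lambda>v. mderiv M f x v - mderiv M f y v) \<le> K * dist x y powr \<rho>)"

definition C1_Holder_diffeo :: "real \<Rightarrow> 'a::euclidean_space set \<Rightarrow> ('a \<Rightarrow> 'a) \<Rightarrow> bool" where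
  "C1_Holder_diffeo \<rho> M f \<longleftrightarrow>
     bij_betw f M M \<and> C1_Holder \<rho> M f \<and> C1_Holder \<rho> M (inv_into M f)"

text \<open>The pairs with \<open>x = y\<close> contribute \<open>0 / 0 = 0\<close> to the Hoelder constant.\<close>

definition C1_Holder_norm :: "real \<Rightarrow> 'a::euclidean_space set \<Rightarrow> ('a \<Rightarrow> 'a) \<Rightarrow> real" where
  "C1_Holder_norm \<rho> M f =
     max (SUP x\<in>M. norm (f x))
       (max (SUP x\<in>M. onorm (mderiv M f x))
          (SUP (x, y)\<in>M \<times> M.
             onorm (\<lambda>v. mderiv M f x v - mderiv M f y v) / dist x y powr \<rho>))"

definition M_const :: "real \<Rightarrow> 'a::euclidean_space set \<Rightarrow> ('a \<Rightarrow> 'a) \<Rightarrow> real" where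
  "M_const \<rho> M f = max (C1_Holder_norm \<rho> M f) (2 powr (1 / \<rho>))"


section \<open>Complexification and hyperbolicity\<close>

definition Re_vec :: "complex ^ 'd \<Rightarrow> real ^ 'd" where
  "Re_vec v = (\<chi> i. Re (v $ i))"

definition Im_vec :: "complex ^ 'd \<Rightarrow> real ^ 'd" where
  "Im_vec v = (\<chi> i. Im (v $ i))"

definition complexify_space :: "(real ^ 'd) set \<Rightarrow> (complex ^ 'd) set" where
  "complexify_space T = {v. Re_vec v \<in> T \<and> Im_vec v \<in> T}"

definition complexify_map :: "(real ^ 'd \<Rightarrow> real ^ 'd) \<Rightarrow> complex ^ 'd \<Rightarrow> complex ^ 'd" where
  "complexify_map L v = (\<chi> i. Complex (L (Re_vec v) $ i) (L (Im_vec v) $ i))"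

text \<open>Below, \<open>T\<close> is a linear subspace and \<open>L\<close> maps \<open>T\<close> linearly to itself.
  The norm on \<^typ>\<open>complex ^ 'd\<close> is the Hermitian one.\<close>

definition complex_eigenvalue ::
  "(real ^ 'd) set \<Rightarrow> (real ^ 'd \<Rightarrow> real ^ 'd) \<Rightarrow> complex \<Rightarrow> bool" where
  "complex_eigenvalue T L z \<longleftrightarrow>
     (\<exists>v\<in>complexify_space T. v \<noteq> 0 \<and> complexify_map L v = z *s v)"

text \<open>Extended-real valued, so that an infimum over the empty set is \<open>\<infinity>\<close>.\<close>

definition hyperbolicity ::
  "(real ^ 'd) set \<Rightarrow> (real ^ 'd \<Rightarrow> real ^ 'd) \<Rightarrow> ereal" where
  "hyperbolicity T L =
     (INF \<phi>\<in>{0..<1::real}. INF v\<in>{v \<in> complexify_space T. norm v = 1}.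
        ereal (norm (complexify_map L v - exp (2 * complex_of_real pi * \<i> * complex_of_real \<phi>) *s v)))"


section \<open>Periodic points\<close>

definition periodic_points :: "'a set \<Rightarrow> ('a \<Rightarrow> 'a) \<Rightarrow> nat \<Rightarrow> 'a set" where
  "periodic_points M f n = {x \<in> M. (f ^^ n) x = x}"

definition hyperbolic_point ::
  "(real ^ 'd) set \<Rightarrow> (real ^ 'd \<Rightarrow> real ^ 'd) \<Rightarrow> nat \<Rightarrow> real ^ 'd \<Rightarrow> bool" where
  "hyperbolic_point M f n x \<longleftrightarrow>
     (\<forall>z. complex_eigenvalue (tangent_space M x) (mderiv M (f ^^ n) x) z \<longrightarrow> cmod z \<noteq> 1)"

definition only_hyperbolic_periodic_points ::
  "(real ^ 'd) set \<Rightarrow> (real ^ 'd \<Rightarrow> real ^ 'd) \<Rightarrow> bool" where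
  "only_hyperbolic_periodic_points M f \<longleftrightarrow>
     (\<forall>n\<ge>1. \<forall>x\<in>periodic_points M f n. hyperbolic_point M f n x)"

definition gamma_point ::
  "nat \<Rightarrow> (real ^ 'd) set \<Rightarrow> (real ^ 'd \<Rightarrow> real ^ 'd) \<Rightarrow> real ^ 'd \<Rightarrow> ereal" where
  "gamma_point n M f x = hyperbolicity (tangent_space M x) (mderiv M (f ^^ n) x)"

definition gamma_min ::
  "nat \<Rightarrow> (real ^ 'd) set \<Rightarrow> (real ^ 'd \<Rightarrow> real ^ 'd) \<Rightarrow> ereal" where
  "gamma_min n M f = (INF x\<in>periodic_points M f n. gamma_point n M f x)"

text \<open>The power \<open>g^(-a)\<close> for \<open>a \<ge> 0\<close>, where \<open>\<infinity>^(-a)\<close> is \<open>0\<close> if \<open>a > 0\<close>. The convention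
  \<open>\<infinity>^0 = 1\<close> matters only on zero-dimensional manifolds, where there are no unit tangent
  vectors.\<close>

definition neg_powr :: "ereal \<Rightarrow> real \<Rightarrow> real" where
  "neg_powr g a =
     (if g = \<infinity> then (if a = 0 then 1 else 0) else real_of_ereal g powr (- a))"

end

theory Submission
  imports Defs
begin

text \<open>
  Two points \<open>x \<noteq> y\<close> with \<open>f^n(x) = x\<close>, \<open>f^n(y) = y\<close> cannot be close: join them by a curve in \<open>M\<close>
  of length \<open>l\<close> and let \<open>w\<close> be the projection of \<open>y - x\<close> to the tangent space at \<open>x\<close>. Along the
  curve, \<open>df^n\<close> varies by at most \<open>B^(n(1+\<rho>)) l^\<rho>\<close> (where \<open>B = M_const \<rho> M f\<close>), so integrating its
  derivative gives \<open>\<gamma>_n |w| \<le> |df^n(x) w - w| \<le> B^(n(1+\<rho>)) l^(1+\<rho>)\<close>. As \<open>l = |w| (1 + O(|x - y|))\<close>,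
  the points are separated by a multiple of \<open>(\<gamma>_n / B^(n(1+\<rho>)))^(1/\<rho>)\<close>, and a separated subset
  of a compact \<open>N\<close>-manifold with mesh \<open>s\<close> has \<open>O(s^(-N))\<close> elements.
\<close>

section \<open>Linear algebra and packing in linear subspaces\<close>

text \<open>The obstacle is that the constant may depend neither on \<open>f\<close> nor on
  \<open>\<rho>\<close>. Solving the pair estimate for the distance takes a
  \<open>1 / \<rho>\<close>-th root, so a mere fixed ratio \<open>q > 1\<close> between the length
  of the joining curve and \<open>norm w\<close> would cost a power of \<open>q\<close> with
  exponent of order \<open>1 / \<rho>\<close>, unbounded as \<open>\<rho>\<close> tends to 0. Hence
  the ratio is kept below \<open>1 + A * dist x y\<close>: at distances of order
  \<open>\<rho>\<close> the root of this distortion stays bounded, and only such distances matter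
  because \<open>M_const\<close> is at least \<open>2 powr (1 / \<rho>)\<close>. The projection to
  the tangent space is needed because \<open>hyperbolicity\<close> controls the derivative of the
  iterate minus the identity on tangent vectors only, while a chord \<open>y - x\<close> is usually
  not tangent. Finiteness of the set of periodic points has to precede the count: an infimum of
  positive numbers over an infinite set could be 0.\<close>

lemma orth_proj_unique:
  assumes "subspace T" "p \<in> T" "\<And>w. w \<in> T \<Longrightarrow> orthogonal (v - p) w"
  shows "orth_proj T v = p"
  unfolding orth_proj_def
proof (rule the_equality)
  show "p \<in> T \<and> (\<forall>w\<in>T. orthogonal (v - p) w)" using assms by blast
next
  fix q assume q: "q \<in> T \<and> (\<forall>w\<in>T. orthogonal (v - q) w)"
  have "p - q \<in> T" using assms q by (simp add: subspace_diff)
  then have "(v - p) \<bullet> (p - q) = 0" "(v - q) \<bullet> (p - q) = 0"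
    using assms(3) q by (auto simp: orthogonal_def)
  then have "(p - q) \<bullet> (p - q) = 0" by (simp add: inner_diff_left)
  then show "q = p" by simp
qed

lemma orth_proj_exists:
  fixes T :: "'a::euclidean_space set"
  assumes "subspace T"
  shows "\<exists>p. p \<in> T \<and> (\<forall>w\<in>T. orthogonal (v - p) w)"
proof -
  obtain y z where "y \<in> span T" "\<And>w. w \<in> span T \<Longrightarrow> orthogonal z w" "v = y + z"
    using orthogonal_subspace_decomp_exists[of T v] by blast
  moreover have "span T = T" using assms by (simp add: span_eq_iff)
  ultimately show ?thesis by (intro exI[of _ y]) auto
qed

lemma
  fixes T :: "'a::euclidean_space set"
  assumes "subspace T"
  shows orth_proj_in: "orth_proj T v \<in> T"
    and orth_proj_orthogonal: "w \<in> T \<Longrightarrow> orthogonal (v - orth_proj T v) w"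
proof -
  obtain p where p: "p \<in> T" "\<forall>w\<in>T. orthogonal (v - p) w"
    using orth_proj_exists[OF assms] by blast
  have eq: "orth_proj T v = p" by (rule orth_proj_unique) (use p assms in auto)
  show "orth_proj T v \<in> T" "w \<in> T \<Longrightarrow> orthogonal (v - orth_proj T v) w"
    using p eq by auto
qed

lemma orth_proj_id:
  fixes T :: "'a::euclidean_space set"
  assumes "subspace T" "v \<in> T"
  shows "orth_proj T v = v"
  by (rule orth_proj_unique) (use assms in \<open>auto simp: orthogonal_def\<close>)

lemma linear_orth_proj:
  fixes T :: "'a::euclidean_space set"
  assumes T: "subspace T"
  shows "linear (orth_proj T)"
proof (rule linearI)
  fix u v :: 'a and a :: real
  note in_T = orth_proj_in[OF T] and orth = orth_proj_orthogonal[OF T, unfolded orthogonal_def]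
  show "orth_proj T (u + v) = orth_proj T u + orth_proj T v"
  proof (rule orth_proj_unique[OF T])
    show "orth_proj T u + orth_proj T v \<in> T" using T in_T by (simp add: subspace_add)
    fix w assume "w \<in> T"
    then show "orthogonal (u + v - (orth_proj T u + orth_proj T v)) w"
      using orth[of w u] orth[of w v] by (simp add: orthogonal_def algebra_simps)
  qed
  show "orth_proj T (a *\<^sub>R v) = a *\<^sub>R orth_proj T v"
  proof (rule orth_proj_unique[OF T])
    show "a *\<^sub>R orth_proj T v \<in> T" using T in_T by (simp add: subspace_scale)
    fix w assume "w \<in> T"
    then show "orthogonal (a *\<^sub>R v - a *\<^sub>R orth_proj T v) w"
      using orth[of w v] by (simp add: orthogonal_def flip: scaleR_diff_right)
  qed
qed

lemma
  fixes T :: "'a::euclidean_space set"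
  assumes T: "subspace T"
  shows norm_orth_proj_le: "norm (orth_proj T v) \<le> norm v"
    and norm_diff_orth_proj_le: "norm (v - orth_proj T v) \<le> norm v"
proof -
  have "orthogonal (v - orth_proj T v) (orth_proj T v)"
    using orth_proj_orthogonal[OF T orth_proj_in[OF T]] .
  then have eq: "norm (v - orth_proj T v) ^ 2 + norm (orth_proj T v) ^ 2 = norm v ^ 2"
    using norm_add_Pythagorean[of "v - orth_proj T v" "orth_proj T v"] by simp
  show "norm (orth_proj T v) \<le> norm v"
    by (rule power2_le_imp_le[OF _ norm_ge_zero]) (metis eq add.commute le_add_same_cancel1 zero_le_power2)
  show "norm (v - orth_proj T v) \<le> norm v"
    by (rule power2_le_imp_le[OF _ norm_ge_zero]) (metis eq le_add_same_cancel1 zero_le_power2)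
qed

lemma bounded_linear_mderiv:
  assumes "subspace (tangent_space M x)" "f differentiable (at x within M)"
  shows "bounded_linear (mderiv M f x)"
  unfolding mderiv_def linear_conv_bounded_linear[symmetric]
  by (rule linear_compose[OF linear_orth_proj linear_frechet_derivative]) (rule assms)+

text \<open>\<open>Ck_on\<close> gives continuity of \<open>x \<mapsto> Dg(x) v\<close> for each
  fixed \<open>v\<close> only. Bounding these maps on the finitely many basis vectors and adding the
  bounds yields a uniform operator norm, after which the mean value inequality applies on the convex
  set \<open>K\<close>.\<close>

lemma C1_imp_lipschitz:
  fixes g :: "'a::euclidean_space \<Rightarrow> 'b::euclidean_space"
  assumes "open S" "Ck_on (Suc 0) S g" "compact K" "convex K" "K \<subseteq> S"
  shows "\<exists>A\<ge>0. \<forall>x\<in>K. \<forall>y\<in>K. norm (g x - g y) \<le> A * norm (x - y)"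
proof -
  have dg: "(g has_derivative frechet_derivative g (at x)) (at x)" if "x \<in> K" for x
    using assms that
    by (metis Ck_on.simps(2) differentiable_on_def frechet_derivative_works subsetD at_within_open)
  have "\<exists>C\<ge>0. \<forall>x\<in>K. norm (frechet_derivative g (at x) b) \<le> C" for b
  proof -
    have "continuous_on K (\<lambda>x. frechet_derivative g (at x) b)"
      using assms by (auto intro: continuous_on_subset)
    then have "bounded ((\<lambda>x. frechet_derivative g (at x) b) ` K)"
      using assms(3) compact_continuous_image compact_imp_bounded by blast
    then obtain C where "\<forall>y\<in>(\<lambda>x. frechet_derivative g (at x) b) ` K. norm y \<le> C"
      by (auto simp: bounded_iff)
    then show ?thesis by (intro exI[of _ "max C 0"]) fastforce
  qed
  then obtain C where C: "\<And>b. C b \<ge> 0" "\<And>b x. x \<in> K \<Longrightarrow> norm (frechet_derivative g (at x) b) \<le> C b"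
    by metis
  define A where "A = (\<Sum>b\<in>Basis. C b)"
  have "norm (g x - g y) \<le> A * norm (x - y)" if "x \<in> K" "y \<in> K" for x y
  proof (rule differentiable_bound[OF assms(4)])
    fix z assume z: "z \<in> K"
    show "(g has_derivative frechet_derivative g (at z)) (at z within K)"
      using dg[OF z] by (rule has_derivative_at_withinI)
    have lin: "linear (frechet_derivative g (at z))"
      using dg[OF z] by (rule has_derivative_linear)
    show "onorm (frechet_derivative g (at z)) \<le> A"
    proof (rule onorm_le)
      fix v :: 'a
      have "frechet_derivative g (at z) v
          = frechet_derivative g (at z) (\<Sum>b\<in>Basis. (v \<bullet> b) *\<^sub>R b)"
        by (simp only: euclidean_representation)
      also have "\<dots> = (\<Sum>b\<in>Basis. (v \<bullet> b) *\<^sub>R frechet_derivative g (at z) b)"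
        by (simp only: linear_sum[OF lin] linear_cmul[OF lin])
      also have "norm \<dots> \<le> (\<Sum>b\<in>Basis. norm v * C b)"
        by (intro sum_norm_le) (auto intro!: mult_mono C z Basis_le_norm)
      finally show "norm (frechet_derivative g (at z) v) \<le> A * norm v"
        by (simp add: A_def sum_distrib_left mult.commute)
    qed
  qed (use that in auto)
  moreover have "A \<ge> 0" unfolding A_def using C by (auto intro: sum_nonneg)
  ultimately show ?thesis by blast
qed

text \<open>Pigeonhole on a grid in orthonormal coordinates of \<open>S\<close>: the cells are so
  small that each holds at most one point of a separated set, and the ball meets
  \<open>O((1 / s) ^ N)\<close> of them.\<close>

lemma separated_card_subspace:
  fixes S :: "'a::euclidean_space set"
  assumes S: "subspace S" "dim S = N" and "R \<ge> 0"
  shows "\<exists>C>0. \<forall>s E. 0 < s \<longrightarrow> s \<le> 1 \<longrightarrow> E \<subseteq> S \<inter> cball 0 R \<longrightarrow>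
           (\<forall>x\<in>E. \<forall>y\<in>E. x \<noteq> y \<longrightarrow> s \<le> dist x y) \<longrightarrow> real (card E) \<le> C * (1 / s) ^ N"
proof -
  obtain B where B: "B \<subseteq> S" "pairwise orthogonal B" "\<And>x. x \<in> B \<Longrightarrow> norm x = 1"
    "independent B" "card B = dim S" "span B = S"
    using orthonormal_basis_subspace[OF S(1)] by metis
  have fB: "finite B" using B(4) independent_imp_finite by blast
  define C where "C = (2 * R * (N + 1) + 3) ^ N"
  have Cpos: "C > 0" unfolding C_def using \<open>R \<ge> 0\<close> by (auto intro!: zero_less_power add_nonneg_pos)
  have "real (card E) \<le> C * (1 / s) ^ N"
    if s: "0 < s" "s \<le> 1" and E: "E \<subseteq> S \<inter> cball 0 R"
      and sep: "\<forall>x\<in>E. \<forall>y\<in>E. x \<noteq> y \<longrightarrow> s \<le> dist x y" for s E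
  proof -
    \<comment> \<open>Cells of side \<open>s / (N + 1)\<close>: two points of one cell are at
      distance at most \<open>N * s / (N + 1)\<close>, which is strictly below \<open>s\<close> also
      for \<open>N = 0\<close>.\<close>
    define k where "k = (N + 1) / s"
    have k: "k > 0" using s by (simp add: k_def)
    define F where "F = (\<lambda>x. \<lambda>b\<in>B. \<lfloor>(x \<bullet> b) * k\<rfloor>)"
    \<comment> \<open>The extra 1 is needed on the negative side, where \<open>floor\<close> rounds
      away from 0. In the final count the additive 3 is at most \<open>3 / s\<close>, as
      \<open>s \<le> 1\<close>.\<close>
    define m where "m = \<lfloor>R * k\<rfloor> + 1"
    have m0: "m \<ge> 0" using \<open>R \<ge> 0\<close> k by (simp add: m_def)
    have range: "F ` E \<subseteq> B \<rightarrow>\<^sub>E {-m..m}"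
    proof -
      have "\<lfloor>(x \<bullet> b) * k\<rfloor> \<in> {-m..m}" if "x \<in> E" "b \<in> B" for x b
      proof -
        have "\<bar>x \<bullet> b\<bar> \<le> R"
          using Cauchy_Schwarz_ineq2[of x b] B(3)[OF that(2)] E that(1) by auto
        then have "\<bar>(x \<bullet> b) * k\<bar> \<le> R * k" using k by (simp add: abs_mult)
        then show ?thesis unfolding m_def by (simp; linarith)
      qed
      then show ?thesis by (auto simp: F_def)
    qed
    have inj: "inj_on F E"
    proof (rule inj_onI, rule ccontr)
      fix x y assume xy: "x \<in> E" "y \<in> E" "F x = F y" "x \<noteq> y"
      have "\<bar>(x - y) \<bullet> b\<bar> \<le> 1 / k" if "b \<in> B" for b
      proof -
        have "\<lfloor>(x \<bullet> b) * k\<rfloor> = \<lfloor>(y \<bullet> b) * k\<rfloor>"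
          using fun_cong[OF xy(3), of b] that by (simp add: F_def)
        then have "\<bar>(x \<bullet> b) * k - (y \<bullet> b) * k\<bar> \<le> 1" by linarith
        then have "\<bar>((x - y) \<bullet> b) * k\<bar> \<le> 1" by (simp add: algebra_simps inner_diff_left)
        then show ?thesis using k by (simp add: abs_mult field_simps)
      qed
      moreover have "x - y \<in> span B" using xy E B(6) S(1) by (auto intro: subspace_diff)
      then have "(\<Sum>b\<in>B. ((x - y) \<bullet> b) *\<^sub>R b) = x - y"
        using orthonormal_basis_expand[OF B(2) B(3) _ fB] by blast
      ultimately have "norm (x - y) \<le> (\<Sum>b\<in>B. 1 / k)"
        using B(3) sum_norm_le[of B "\<lambda>b. ((x - y) \<bullet> b) *\<^sub>R b" "\<lambda>b. 1 / k"] by simp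
      also have "\<dots> = N / k" using B(5) S(2) by simp
      also have "\<dots> < s" using s by (simp add: k_def field_simps)
      finally show False using sep xy by (force simp: dist_norm)
    qed
    have "card E \<le> card (B \<rightarrow>\<^sub>E {-m..m})"
      by (rule card_inj_on_le[OF inj range]) (auto intro: finite_PiE fB)
    also have "\<dots> = nat (2 * m + 1) ^ N"
      using fB B(5) S(2) m0 by (simp add: card_PiE)
    finally have "real (card E) \<le> real (nat (2 * m + 1)) ^ N" by (metis of_nat_le_iff of_nat_power)
    also have "\<dots> \<le> ((2 * R * (N + 1) + 3) * (1 / s)) ^ N"
    proof (rule power_mono)
      have "real (nat (2 * m + 1)) = 2 * of_int m + 1" using m0 by simp
      also have "\<dots> \<le> 2 * (R * k) + 3" unfolding m_def by simp
      also have "\<dots> \<le> (2 * R * (N + 1) + 3) * (1 / s)" using s by (simp add: k_def field_simps)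
      finally show "real (nat (2 * m + 1)) \<le> (2 * R * (N + 1) + 3) * (1 / s)" .
    qed simp
    finally show ?thesis by (simp add: C_def power_mult_distrib power_divide)
  qed
  then show ?thesis using Cpos by blast
qed

section \<open>Slice charts and almost geodesic curves\<close>

text \<open>A speed bound over the unit parameter interval stands in for a length bound, so that the
  mean value inequality suffices and \<open>c'\<close> needs no regularity. The speed is compared
  with the tangential part of \<open>y - x\<close> because this is the vector to which
  \<open>hyperbolicity\<close> is later applied.\<close>

definition near_geodesic :: "'a::euclidean_space set \<Rightarrow> real \<Rightarrow> 'a \<Rightarrow> 'a \<Rightarrow> bool" where
  "near_geodesic M A x y \<longleftrightarrow>
     (\<exists>c c'. c 0 = x \<and> c 1 = y \<and>
        (\<forall>t\<in>{0..1::real}. c t \<in> M \<and> c' t \<in> tangent_space M (c t) \<and>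
           (c has_vector_derivative c' t) (at t within {0..1}) \<and>
           norm (c' t) \<le> (1 + A * dist x y) * norm (orth_proj (tangent_space M x) (y - x))))"

locale slice_chart =
  fixes N :: nat and M U V S :: "'a::euclidean_space set" and \<phi> \<psi> :: "'a \<Rightarrow> 'a"
  assumes open_U: "open U" and open_V: "open V" and homeo: "homeomorphism U V \<phi> \<psi>"
    and smooth_\<phi>: "smooth_on U \<phi>" and smooth_\<psi>: "smooth_on V \<psi>"
    and subspace_S: "subspace S" and dim_S: "dim S = N"
    and image_slice: "\<phi> ` (U \<inter> M) = V \<inter> S"
begin

abbreviation D\<phi> where "D\<phi> x \<equiv> frechet_derivative \<phi> (at x)"
abbreviation D\<psi> where "D\<psi> z \<equiv> frechet_derivative \<psi> (at z)"

lemma \<psi>_in: "z \<in> V \<Longrightarrow> z \<in> S \<Longrightarrow> \<psi> z \<in> U \<inter> M"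
  using image_slice homeo unfolding homeomorphism_def by (smt (verit) IntI IntE imageE)

lemma \<phi>_in: "x \<in> U \<Longrightarrow> x \<in> M \<Longrightarrow> \<phi> x \<in> V \<inter> S"
  using image_slice by blast

lemma \<psi>_\<phi>: "x \<in> U \<Longrightarrow> \<psi> (\<phi> x) = x" and \<phi>_\<psi>: "z \<in> V \<Longrightarrow> \<phi> (\<psi> z) = z"
  using homeo by (auto simp: homeomorphism_def)

lemma D\<phi>: "x \<in> U \<Longrightarrow> (\<phi> has_derivative D\<phi> x) (at x)"
  using smooth_\<phi> open_U unfolding smooth_on_def
  by (metis Ck_on.simps(2) at_within_open differentiable_on_def frechet_derivative_works)

lemma D\<psi>: "z \<in> V \<Longrightarrow> (\<psi> has_derivative D\<psi> z) (at z)"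
  using smooth_\<psi> open_V unfolding smooth_on_def
  by (metis Ck_on.simps(2) at_within_open differentiable_on_def frechet_derivative_works)

lemma D\<psi>_linear: "z \<in> V \<Longrightarrow> linear (D\<psi> z)"
  using D\<psi> has_derivative_linear by blast

lemma D\<psi>_eq_0:
  assumes "z \<in> V" "D\<psi> z u = 0"
  shows "u = 0"
proof -
  have "\<psi> z \<in> U" using assms homeo by (auto simp: homeomorphism_def)
  have "((\<phi> \<circ> \<psi>) has_derivative (D\<phi> (\<psi> z) \<circ> D\<psi> z)) (at z)"
    by (rule diff_chain_at[OF D\<psi> D\<phi>]) fact+
  then have "((\<lambda>z. z) has_derivative (D\<phi> (\<psi> z) \<circ> D\<psi> z)) (at z)"
    by (rule has_derivative_transform_within_open[OF _ open_V assms(1)]) (simp add: \<phi>_\<psi>)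
  then have "D\<phi> (\<psi> z) \<circ> D\<psi> z = (\<lambda>z. z)"
    using has_derivative_ident has_derivative_unique by blast
  then have "u = D\<phi> (\<psi> z) (D\<psi> z u)" by (metis comp_apply)
  then show ?thesis
    using assms D\<phi>[OF \<open>\<psi> z \<in> U\<close>] by (metis has_derivative_linear linear_0)
qed

lemma \<psi>_segment_derivative:
  assumes "z + t *\<^sub>R u \<in> V"
  shows "((\<lambda>t. \<psi> (z + t *\<^sub>R u)) has_vector_derivative D\<psi> (z + t *\<^sub>R u) u) (at t within T)"
proof -
  have "((\<lambda>t. z + t *\<^sub>R u) has_derivative (\<lambda>h. h *\<^sub>R u)) (at t within T)"
    by (auto intro!: derivative_eq_intros)
  then have "(\<psi> \<circ> (\<lambda>t. z + t *\<^sub>R u) has_derivative D\<psi> (z + t *\<^sub>R u) \<circ> (\<lambda>h. h *\<^sub>R u)) (at t within T)"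
    by (rule diff_chain_within) (use D\<psi>[OF assms] has_derivative_at_withinI in blast)
  then show ?thesis
    using D\<psi>_linear[OF assms] by (simp add: has_vector_derivative_def o_def linear_cmul)
qed

text \<open>Segments in \<open>S\<close> are carried by \<open>\<psi>\<close> to curves in
  \<open>M\<close>; conversely a curve in \<open>M\<close> through \<open>\<psi> z\<close>, read in
  the chart, runs in \<open>S\<close> near time 0. This is how the velocities of curves turn out to
  form a linear space.\<close>

lemma tangent_space_eq:
  assumes z: "z \<in> V" "z \<in> S"
  shows "tangent_space M (\<psi> z) = D\<psi> z ` S"
proof (intro subset_antisym subsetI)
  fix v assume "v \<in> D\<psi> z ` S"
  then obtain u where u: "u \<in> S" "v = D\<psi> z u" by blast
  have "open ((\<lambda>t. z + t *\<^sub>R u) -` V)"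
    by (intro open_vimage open_V continuous_intros)
  moreover have "0 \<in> (\<lambda>t. z + t *\<^sub>R u) -` V" using z by simp
  ultimately obtain e where e: "e > 0" "ball 0 e \<subseteq> (\<lambda>t. z + t *\<^sub>R u) -` V"
    by (rule openE)
  have "z + t *\<^sub>R u \<in> V" if "\<bar>t\<bar> < e" for t
    using subsetD[OF e(2), of t] that by (simp add: dist_real_def)
  note e = e(1) this
  have "\<psi> (z + t *\<^sub>R u) \<in> M" if "\<bar>t\<bar> < e" for t
    using \<psi>_in[of "z + t *\<^sub>R u"] e(2)[OF that] u z subspace_S by (simp add: subspace_add subspace_scale)
  moreover have "((\<lambda>t. \<psi> (z + t *\<^sub>R u)) has_vector_derivative v) (at 0)"
    using \<psi>_segment_derivative[of z 0 u UNIV] z u by simp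
  ultimately show "v \<in> tangent_space M (\<psi> z)"
    unfolding tangent_space_def using e(1)
    by (intro CollectI exI[of _ "\<lambda>t. \<psi> (z + t *\<^sub>R u)"] exI[of _ e]) auto
next
  fix v assume "v \<in> tangent_space M (\<psi> z)"
  then obtain c e where c: "e > 0" "\<And>t. \<bar>t\<bar> < e \<Longrightarrow> c t \<in> M" "c 0 = \<psi> z"
    "(c has_vector_derivative v) (at (0::real))"
    unfolding tangent_space_def by blast
  have zU: "\<psi> z \<in> U" using \<psi>_in z by blast
  have "isCont c 0" using c(4) has_vector_derivative_continuous by blast
  then have "\<forall>\<^sub>F t in nhds 0. c t \<in> U"
    using zU c(3) open_U by (simp add: continuous_at_open eventually_nhds)
  moreover have "\<forall>\<^sub>F t in nhds 0. \<bar>t\<bar> < e"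
    using c(1) by (auto simp: eventually_nhds_metric dist_real_def)
  ultimately have ev: "\<forall>\<^sub>F t in nhds 0. c t \<in> U \<and> c t \<in> M"
    by eventually_elim (use c in auto)
  define w where "w = D\<phi> (\<psi> z) v"
  have d1: "((\<lambda>t. \<phi> (c t)) has_vector_derivative w) (at 0)"
  proof -
    have "(\<phi> \<circ> c has_derivative D\<phi> (\<psi> z) \<circ> (\<lambda>h. h *\<^sub>R v)) (at 0)"
      by (rule diff_chain_at) (use c zU D\<phi> in \<open>auto simp: has_vector_derivative_def\<close>)
    then show ?thesis
      using D\<phi>[OF zU] by (simp add: has_vector_derivative_def o_def w_def linear_cmul has_derivative_linear)
  qed
  have "w \<in> S"
  proof -
    \<comment> \<open>The linear map \<open>q\<close> has kernel \<open>S\<close> and kills the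
      curve \<open>\<phi> \<circ> c\<close> near time 0. Its derivative \<open>q w\<close> is
      therefore 0, which places \<open>w\<close> in \<open>S\<close>.\<close>
    define q where "q y = y - orth_proj S y" for y
    have "bounded_linear q"
      unfolding q_def linear_conv_bounded_linear[symmetric]
      by (intro linear_compose_sub linear_ident linear_orth_proj subspace_S)
    then have "((\<lambda>t. q (\<phi> (c t))) has_vector_derivative q w) (at 0)"
      using d1 bounded_linear.has_vector_derivative by blast
    moreover have "\<forall>\<^sub>F t in nhds 0. q (\<phi> (c t)) = 0"
      using ev by eventually_elim (use \<phi>_in orth_proj_id[OF subspace_S] in \<open>force simp: q_def\<close>)
    ultimately have "((\<lambda>t. 0) has_vector_derivative q w) (at 0)"
      using has_vector_derivative_cong_ev[where x = 0 and S = UNIV and f = "\<lambda>t. q (\<phi> (c t))" and g = "\<lambda>t. 0"]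
        eventually_nhds_x_imp_x by (force elim!: eventually_mono)
    then have "q w = 0"
      using vector_derivative_unique_at has_vector_derivative_const by blast
    then show ?thesis using orth_proj_in[OF subspace_S, of w] by (simp add: q_def)
  qed
  moreover have "v = D\<psi> z w"
  proof -
    have "(\<psi> \<circ> (\<lambda>t. \<phi> (c t)) has_derivative D\<psi> z \<circ> (\<lambda>h. h *\<^sub>R w)) (at 0)"
      by (rule diff_chain_at) (use c z d1 D\<psi> \<phi>_\<psi> in \<open>auto simp: has_vector_derivative_def\<close>)
    then have "((\<lambda>t. \<psi> (\<phi> (c t))) has_vector_derivative D\<psi> z w) (at 0)"
      using D\<psi>_linear[OF z(1)] by (simp add: has_vector_derivative_def o_def linear_cmul)
    moreover have "\<forall>\<^sub>F t in nhds 0. \<psi> (\<phi> (c t)) = c t"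
      using ev by eventually_elim (simp add: \<psi>_\<phi>)
    ultimately have "(c has_vector_derivative D\<psi> z w) (at 0)"
      using has_vector_derivative_cong_ev[where x = 0 and S = UNIV and f = "\<lambda>t. \<psi> (\<phi> (c t))" and g = c]
        eventually_nhds_x_imp_x by (force elim!: eventually_mono)
    then show ?thesis using c(4) vector_derivative_unique_at by blast
  qed
  ultimately show "v \<in> D\<psi> z ` S" by blast
qed

lemma subspace_tangent_space: "x \<in> U \<Longrightarrow> x \<in> M \<Longrightarrow> subspace (tangent_space M x)"
  using tangent_space_eq[of "\<phi> x"] \<phi>_in[of x] \<psi>_\<phi>[of x] subspace_S D\<psi>_linear[of "\<phi> x"]
  by (simp add: linear_subspace_image)

lemma tangent_space_nontrivial:
  assumes "x \<in> U" "x \<in> M" "N \<ge> 1"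
  shows "\<exists>v\<in>tangent_space M x. v \<noteq> 0"
proof -
  obtain u where "u \<in> S" "u \<noteq> 0"
    using dim_S \<open>N \<ge> 1\<close> dim_eq_0[of S] by (cases "S \<subseteq> {0}") auto
  then show ?thesis
    using tangent_space_eq[of "\<phi> x"] \<phi>_in[of x] \<psi>_\<phi>[of x] D\<psi>_eq_0[of "\<phi> x" u] assms by auto
qed

text \<open>The image under \<open>\<psi>\<close> of the segment from \<open>\<phi> x\<close> to \<open>\<phi> y\<close> is a curve whose speed
  exceeds \<open>norm w\<close>, and hence \<open>dist x y\<close>, only by a relative error \<open>O(dist x y)\<close>.\<close>

lemma local_geometry:
  assumes p: "p \<in> U" "p \<in> M"
  shows "\<exists>\<epsilon>>0. \<exists>A\<ge>0. \<forall>x\<in>M \<inter> ball p \<epsilon>. \<forall>y\<in>M \<inter> ball p \<epsilon>. near_geodesic M A x y"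
    and "\<exists>\<epsilon>>0. \<exists>C>0. \<forall>s E. 0 < s \<longrightarrow> s \<le> 1 \<longrightarrow> E \<subseteq> M \<inter> ball p \<epsilon> \<longrightarrow>
           (\<forall>x\<in>E. \<forall>y\<in>E. x \<noteq> y \<longrightarrow> s \<le> dist x y) \<longrightarrow> real (card E) \<le> C * (1 / s) ^ N"
proof -
  define q where "q = \<phi> p"
  have "q \<in> V" using \<phi>_in p by (simp add: q_def)
  then obtain \<delta> where \<delta>: "\<delta> > 0" "cball q \<delta> \<subseteq> V"
    using open_V open_contains_cball by meson
  have "isCont \<phi> p" using D\<phi>[OF p(1)] has_derivative_continuous by blast
  then obtain \<epsilon>1 where \<epsilon>1: "\<epsilon>1 > 0" "\<And>x. dist x p < \<epsilon>1 \<Longrightarrow> dist (\<phi> x) q < \<delta>"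
    using \<open>\<delta> > 0\<close> unfolding continuous_at_eps_delta q_def by blast
  obtain \<epsilon>2 where \<epsilon>2: "\<epsilon>2 > 0" "cball p \<epsilon>2 \<subseteq> U"
    using open_U open_contains_cball p by meson
  have C1: "Ck_on (Suc 0) U \<phi>" "Ck_on (Suc 0) V \<psi>" "\<And>v. Ck_on (Suc 0) V (\<lambda>z. D\<psi> z v)"
    using smooth_\<phi> smooth_\<psi> Ck_on.simps(2)[of "Suc 0" V \<psi>] unfolding smooth_on_def by blast+
  obtain A1 where A1: "A1 \<ge> 0" "\<And>x y. x \<in> cball p \<epsilon>2 \<Longrightarrow> y \<in> cball p \<epsilon>2 \<Longrightarrow>
      norm (\<phi> x - \<phi> y) \<le> A1 * norm (x - y)"
    using C1_imp_lipschitz[OF open_U C1(1) _ _ \<epsilon>2(2)] by auto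
  obtain A2 where A2: "A2 \<ge> 0" "\<And>x y. x \<in> cball q \<delta> \<Longrightarrow> y \<in> cball q \<delta> \<Longrightarrow>
      norm (\<psi> x - \<psi> y) \<le> A2 * norm (x - y)"
    using C1_imp_lipschitz[OF open_V C1(2) _ _ \<delta>(2)] by auto
  have "\<forall>b. \<exists>A\<ge>0. \<forall>x\<in>cball q \<delta>. \<forall>y\<in>cball q \<delta>. norm (D\<psi> x b - D\<psi> y b) \<le> A * norm (x - y)"
    using C1_imp_lipschitz[OF open_V C1(3) _ _ \<delta>(2)] by auto
  then obtain A' where A': "\<And>b. A' b \<ge> 0" "\<And>b x y. x \<in> cball q \<delta> \<Longrightarrow> y \<in> cball q \<delta> \<Longrightarrow>
      norm (D\<psi> x b - D\<psi> y b) \<le> A' b * norm (x - y)" by metis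
  define A3 where "A3 = (\<Sum>b\<in>Basis. A' b)"
  have "A3 \<ge> 0" unfolding A3_def using A' by (auto intro: sum_nonneg)
  have A3: "norm (D\<psi> x u - D\<psi> y u) \<le> A3 * norm (x - y) * norm u"
    if xy: "x \<in> cball q \<delta>" "y \<in> cball q \<delta>" for x y u
  proof -
    have lin: "linear (\<lambda>u. D\<psi> x u - D\<psi> y u)"
      using xy \<delta> D\<psi>_linear by (intro linear_compose_sub) auto
    have "D\<psi> x u - D\<psi> y u = (\<lambda>u. D\<psi> x u - D\<psi> y u) (\<Sum>b\<in>Basis. (u \<bullet> b) *\<^sub>R b)"
      by (simp only: euclidean_representation)
    also have "\<dots> = (\<Sum>b\<in>Basis. (u \<bullet> b) *\<^sub>R (D\<psi> x b - D\<psi> y b))"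
      by (simp only: linear_sum[OF lin] linear_cmul[OF lin])
    also have "norm \<dots> \<le> (\<Sum>b\<in>Basis. norm u * (A' b * norm (x - y)))"
    proof (intro sum_norm_le)
      fix b :: 'a assume "b \<in> Basis"
      then show "norm ((u \<bullet> b) *\<^sub>R (D\<psi> x b - D\<psi> y b)) \<le> norm u * (A' b * norm (x - y))"
        using A'(2)[OF xy] by (auto intro!: mult_mono Basis_le_norm)
    qed
    finally show ?thesis by (simp add: A3_def sum_distrib_left sum_distrib_right mult_ac)
  qed
  \<comment> \<open>The velocity of the curve varies by at most \<open>A3 * norm u * norm u\<close>,
    where \<open>norm u \<le> A1 * r\<close>.\<close>
  define A where "A = A3 * A1\<^sup>2"
  have "A \<ge> 0" using \<open>A3 \<ge> 0\<close> by (simp add: A_def)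
  \<comment> \<open>Points of the ball are at distance \<open>r < 2 * \<epsilon>\<close>, so the
    last entry forces \<open>A * r\<^sup>2 \<le> r / 2\<close>. Then the tangential part
    \<open>w\<close> keeps at least half of the length of \<open>y - x\<close>.\<close>
  define \<epsilon> where "\<epsilon> = min (min \<epsilon>1 \<epsilon>2) (1 / (4 * A + 4))"
  have \<epsilon>: "\<epsilon> > 0" "\<epsilon> \<le> \<epsilon>1" "\<epsilon> \<le> \<epsilon>2" "4 * A * \<epsilon> \<le> 1"
  proof -
    have "4 * A * \<epsilon> \<le> 4 * A * (1 / (4 * A + 4))"
      by (intro mult_left_mono) (use \<open>A \<ge> 0\<close> in \<open>auto simp: \<epsilon>_def\<close>)
    also have "\<dots> \<le> 1" using \<open>A \<ge> 0\<close> by (simp add: field_simps)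
    finally show "4 * A * \<epsilon> \<le> 1" .
  qed (use \<open>A \<ge> 0\<close> \<epsilon>1 \<epsilon>2 in \<open>auto simp: \<epsilon>_def\<close>)
  have ball: "x \<in> U" "x \<in> cball p \<epsilon>2" "\<phi> x \<in> cball q \<delta>" "\<phi> x \<in> V" "\<phi> x \<in> S" "\<psi> (\<phi> x) = x"
    if "x \<in> M" "x \<in> ball p \<epsilon>" for x
  proof -
    show "x \<in> cball p \<epsilon>2" using that \<epsilon> by auto
    then show "x \<in> U" using \<epsilon>2 by auto
    then show "\<phi> x \<in> V" "\<phi> x \<in> S" "\<psi> (\<phi> x) = x" using \<phi>_in \<psi>_\<phi> that by auto
    show "\<phi> x \<in> cball q \<delta>" using \<epsilon>1(2)[of x] that \<epsilon> by (auto simp: dist_commute)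
  qed
  \<comment> \<open>The speed exceeds \<open>norm w\<close> by at most
    \<open>2 * A * r\<^sup>2\<close>: one share from the variation of \<open>c'\<close>, one from
    replacing \<open>c' 0\<close> by \<open>w\<close>. Trading one factor \<open>r\<close> for
    \<open>2 * norm w\<close> gives the 4.\<close>
  have "near_geodesic M (4 * A) x y" if x: "x \<in> M" "x \<in> ball p \<epsilon>" and y: "y \<in> M" "y \<in> ball p \<epsilon>" for x y
  proof -
    define z where "z = \<phi> x"
    define u where "u = \<phi> y - \<phi> x"
    define T where "T = tangent_space M x"
    define w where "w = orth_proj T (y - x)"
    define r where "r = norm (y - x)"
    have T: "subspace T" unfolding T_def using subspace_tangent_space ball[OF x] x by blast
    have "u \<in> S" using ball[OF x] ball[OF y] subspace_S by (simp add: u_def subspace_diff)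
    have seg: "z + t *\<^sub>R u \<in> cball q \<delta> \<and> z + t *\<^sub>R u \<in> V \<and> z + t *\<^sub>R u \<in> S" if "t \<in> {0..1}" for t
    proof -
      have "(1 - t) *\<^sub>R \<phi> x + t *\<^sub>R \<phi> y \<in> cball q \<delta>"
        by (rule convexD) (use that ball[OF x] ball[OF y] in auto)
      moreover have "(1 - t) *\<^sub>R \<phi> x + t *\<^sub>R \<phi> y = z + t *\<^sub>R u"
        by (simp add: z_def u_def algebra_simps)
      ultimately show ?thesis
        using \<delta> \<open>u \<in> S\<close> ball[OF x] subspace_S by (auto simp: z_def subspace_add subspace_scale)
    qed
    define c where "c t = \<psi> (z + t *\<^sub>R u)" for t
    define c' where "c' t = D\<psi> (z + t *\<^sub>R u) u" for t
    have cM: "c t \<in> M" if "t \<in> {0..1}" for t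
      using seg[OF that] \<psi>_in by (auto simp: c_def)
    have c'T: "c' t \<in> tangent_space M (c t)" if "t \<in> {0..1}" for t
      using seg[OF that] tangent_space_eq \<open>u \<in> S\<close> by (auto simp: c_def c'_def)
    have cd: "(c has_vector_derivative c' t) (at t within {0..1})" if "t \<in> {0..1}" for t
      using seg[OF that] \<psi>_segment_derivative by (auto simp: c_def[abs_def] c'_def)
    have c01: "c 0 = x" "c 1 = y"
      using ball[OF x] ball[OF y] by (auto simp: c_def z_def u_def)
    have nu: "norm u \<le> A1 * r"
      unfolding u_def r_def using A1(2) ball[OF x] ball[OF y] by blast
    have err: "norm (c' t - c' 0) \<le> A * r\<^sup>2" if "t \<in> {0..1}" for t
    proof -
      have "norm (c' t - c' 0) \<le> A3 * norm (t *\<^sub>R u) * norm u"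
        using A3[of "z + t *\<^sub>R u" "z + 0 *\<^sub>R u" u] seg[OF that] seg[of 0] by (simp add: c'_def)
      also have "\<dots> \<le> A3 * norm u * norm u"
        using that \<open>A3 \<ge> 0\<close> by (intro mult_right_mono mult_left_mono) (auto intro: mult_left_le_one_le)
      also have "\<dots> \<le> A3 * (A1 * r) * (A1 * r)"
        using nu \<open>A3 \<ge> 0\<close> by (intro mult_mono) (auto simp: order_trans[OF norm_ge_zero nu])
      finally show ?thesis by (simp add: A_def power2_eq_square mult_ac)
    qed
    have "norm ((y - 1 *\<^sub>R c' 0) - (x - 0 *\<^sub>R c' 0)) \<le> A * r\<^sup>2 * norm (1 - (0::real))"
    proof (subst c01[symmetric], subst c01(2)[symmetric], rule differentiable_bound[of "{0..1}" "\<lambda>t. c t - t *\<^sub>R c' 0"])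
      fix t :: real assume t: "t \<in> {0..1}"
      show "((\<lambda>t. c t - t *\<^sub>R c' 0) has_derivative (\<lambda>h. h *\<^sub>R (c' t - c' 0))) (at t within {0..1})"
        using cd[OF t] unfolding has_vector_derivative_def
        by (auto intro!: derivative_eq_intros simp: algebra_simps)
      show "onorm (\<lambda>h. h *\<^sub>R (c' t - c' 0)) \<le> A * r\<^sup>2"
        by (rule onorm_le) (use err[OF t] in \<open>simp add: mult.commute mult_left_mono\<close>)
    qed auto
    then have e1: "norm ((y - x) - c' 0) \<le> A * r\<^sup>2" by (simp add: algebra_simps)
    have "c' 0 \<in> T" using c'T[of 0] c01 by (simp add: T_def)
    \<comment> \<open>As \<open>c' 0\<close> is tangent at \<open>x\<close>, the differences
      \<open>w - c' 0\<close> and \<open>(y - x) - w\<close> are the two complementary projections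
      of the single error \<open>d\<close>, so neither exceeds it in norm.\<close>
    define d where "d = (y - x) - c' 0"
    have w: "w = c' 0 + orth_proj T d"
      using linear_add[OF linear_orth_proj[OF T], of "c' 0" d] orth_proj_id[OF T \<open>c' 0 \<in> T\<close>]
      by (simp add: d_def w_def)
    have "norm (w - c' 0) \<le> A * r\<^sup>2"
      using norm_orth_proj_le[OF T, of d] e1 by (simp add: w d_def[symmetric])
    moreover have "norm ((y - x) - w) \<le> A * r\<^sup>2"
      using norm_diff_orth_proj_le[OF T, of d] e1 by (simp add: w d_def[symmetric] algebra_simps) (simp add: d_def algebra_simps)
    moreover have "r \<le> norm w + norm ((y - x) - w)"
      unfolding r_def using norm_triangle_sub[of "y - x" w] by simp
    moreover have "A * r\<^sup>2 \<le> r / 2"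
    proof -
      have "r < 2 * \<epsilon>"
        unfolding r_def using dist_triangle_half_r[of p y "2 * \<epsilon>" x] x y by (simp add: dist_norm)
      then have "A * r * r \<le> A * (2 * \<epsilon>) * r"
        using \<open>A \<ge> 0\<close> by (intro mult_right_mono mult_left_mono) (auto simp: r_def)
      also have "\<dots> \<le> (1 / 2) * r"
        using \<epsilon>(4) by (intro mult_right_mono) (auto simp: r_def)
      finally show ?thesis by (simp add: power2_eq_square mult_ac)
    qed
    ultimately have rw: "r \<le> 2 * norm w" and wc: "norm (w - c' 0) \<le> A * r\<^sup>2" by linarith+
    have speed: "norm (c' t) \<le> (1 + 4 * A * dist x y) * norm w" if "t \<in> {0..1}" for t
    proof -
      have "norm (c' t) \<le> norm (c' t - c' 0) + norm (c' 0 - w) + norm w"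
        using norm_triangle_ineq[of "c' t - c' 0" "c' 0"] norm_triangle_ineq[of "c' 0 - w" w] by simp
      also have "\<dots> \<le> 2 * A * r * r + norm w"
        using err[OF that] wc by (simp add: norm_minus_commute power2_eq_square)
      also have "\<dots> \<le> 2 * A * r * (2 * norm w) + norm w"
        using rw \<open>A \<ge> 0\<close> by (intro add_right_mono mult_left_mono) (auto simp: r_def)
      finally show ?thesis by (simp add: r_def dist_norm norm_minus_commute algebra_simps)
    qed
    show ?thesis
      unfolding near_geodesic_def
      by (rule exI[of _ c], rule exI[of _ c']) (use cM c'T cd c01 speed in \<open>auto simp: w_def T_def\<close>)
  qed
  then show "\<exists>\<epsilon>>0. \<exists>A\<ge>0. \<forall>x\<in>M \<inter> ball p \<epsilon>. \<forall>y\<in>M \<inter> ball p \<epsilon>. near_geodesic M A x y"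
    using \<open>A \<ge> 0\<close> \<epsilon>(1) by (intro exI[of _ \<epsilon>] exI[of _ "4 * A"] conjI) auto
  obtain C where C: "C > 0" "\<And>s E. 0 < s \<Longrightarrow> s \<le> 1 \<Longrightarrow> E \<subseteq> S \<inter> cball 0 (norm q + \<delta>) \<Longrightarrow>
           (\<forall>x\<in>E. \<forall>y\<in>E. x \<noteq> y \<longrightarrow> s \<le> dist x y) \<Longrightarrow> real (card E) \<le> C * (1 / s) ^ N"
    using separated_card_subspace[OF subspace_S dim_S, of "norm q + \<delta>"] \<delta>(1) by auto
  \<comment> \<open>Since \<open>\<psi>\<close> is \<open>A2\<close>-Lipschitz, passing to the chart
    shrinks separations by at most the factor \<open>A2 + 1\<close>. The added 1 avoids division by
    0 and keeps the new scale at most 1.\<close>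
  have "real (card E) \<le> C * (A2 + 1) ^ N * (1 / s) ^ N"
    if s: "0 < s" "s \<le> 1" and E: "E \<subseteq> M \<inter> ball p \<epsilon>" and sep: "\<forall>x\<in>E. \<forall>y\<in>E. x \<noteq> y \<longrightarrow> s \<le> dist x y" for s E
  proof -
    have E: "x \<in> M" "x \<in> ball p \<epsilon>" if "x \<in> E" for x using E that by auto
    have "inj_on \<phi> E"
      by (rule inj_on_inverseI[of _ \<psi>]) (rule ball(6)[OF E])
    then have "card E = card (\<phi> ` E)" by (simp add: card_image)
    also have "real \<dots> \<le> C * (1 / (s / (A2 + 1))) ^ N"
    proof (rule C(2))
      show "0 < s / (A2 + 1)" "s / (A2 + 1) \<le> 1" using s A2(1) by (auto simp: field_simps)
      show "\<phi> ` E \<subseteq> S \<inter> cball 0 (norm q + \<delta>)"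
      proof
        fix z assume "z \<in> \<phi> ` E"
        then have "z \<in> S" "z \<in> cball q \<delta>" using ball(3,5)[OF E] by auto
        then show "z \<in> S \<inter> cball 0 (norm q + \<delta>)"
          using norm_triangle_sub[of z q] by (auto simp: dist_norm norm_minus_commute)
      qed
      have "s / (A2 + 1) \<le> dist (\<phi> x) (\<phi> y)" if "x \<in> E" "y \<in> E" "\<phi> x \<noteq> \<phi> y" for x y
      proof -
        have "x \<noteq> y" using that(3) by auto
        then have "s \<le> dist x y" using sep that(1,2) by simp
        also have "\<dots> \<le> A2 * dist (\<phi> x) (\<phi> y)"
          using A2(2)[of "\<phi> x" "\<phi> y"] ball[OF E, of x] ball[OF E, of y] that by (auto simp: dist_norm)
        also have "\<dots> \<le> (A2 + 1) * dist (\<phi> x) (\<phi> y)" by (intro mult_right_mono) auto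
        finally show ?thesis using A2(1) by (simp add: field_simps)
      qed
      then show "\<forall>x\<in>\<phi> ` E. \<forall>y\<in>\<phi> ` E. x \<noteq> y \<longrightarrow> s / (A2 + 1) \<le> dist x y" by blast
    qed
    also have "\<dots> = C * (A2 + 1) ^ N * (1 / s) ^ N" by (simp add: power_divide)
    finally show ?thesis .
  qed
  then show "\<exists>\<epsilon>>0. \<exists>C>0. \<forall>s E. 0 < s \<longrightarrow> s \<le> 1 \<longrightarrow> E \<subseteq> M \<inter> ball p \<epsilon> \<longrightarrow>
           (\<forall>x\<in>E. \<forall>y\<in>E. x \<noteq> y \<longrightarrow> s \<le> dist x y) \<longrightarrow> real (card E) \<le> C * (1 / s) ^ N"
    using \<epsilon>(1) C(1) A2(1)
    by (intro exI[of _ \<epsilon>] exI[of _ "C * (A2 + 1) ^ N"] conjI) (auto intro!: mult_pos_pos zero_less_power)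
qed

end

section \<open>From single charts to uniform bounds on a compact submanifold\<close>

lemma smooth_submanifold_chart:
  assumes "smooth_submanifold N M" "p \<in> M"
  obtains U V S \<phi> \<psi> where "slice_chart N M U V S \<phi> \<psi>" "p \<in> U"
  using assms unfolding smooth_submanifold_def slice_chart_def by metis

lemma submanifold_subspace_tangent_space:
  "smooth_submanifold N M \<Longrightarrow> x \<in> M \<Longrightarrow> subspace (tangent_space M x)"
  using smooth_submanifold_chart slice_chart.subspace_tangent_space by metis

lemma submanifold_tangent_space_nontrivial:
  "smooth_submanifold N M \<Longrightarrow> x \<in> M \<Longrightarrow> N \<ge> 1 \<Longrightarrow> \<exists>v\<in>tangent_space M x. v \<noteq> 0"
  using smooth_submanifold_chart slice_chart.tangent_space_nontrivial by metis

lemma near_geodesic_mono: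
  assumes "near_geodesic M A x y" "A \<le> A'"
  shows "near_geodesic M A' x y"
proof -
  have "(1 + A * dist x y) * norm v \<le> (1 + A' * dist x y) * norm v" for v :: 'a
    using assms(2) by (intro mult_right_mono add_left_mono) auto
  moreover obtain c c' where "c 0 = x" "c 1 = y"
    "\<forall>t\<in>{0..1::real}. c t \<in> M \<and> c' t \<in> tangent_space M (c t) \<and>
       (c has_vector_derivative c' t) (at t within {0..1}) \<and>
       norm (c' t) \<le> (1 + A * dist x y) * norm (orth_proj (tangent_space M x) (y - x))"
    using assms(1) unfolding near_geodesic_def by blast
  ultimately show ?thesis
    unfolding near_geodesic_def by (intro exI[of _ c] exI[of _ c']) (auto intro: order_trans)
qed

text \<open>The radius \<open>r\<close> is a Lebesgue number of a finite subcover by the local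
  balls: two points closer than \<open>r\<close> lie in a common ball. The sum of the finitely many
  local constants dominates each of them.\<close>

lemma compact_submanifold_near_geodesic:
  fixes M :: "'a::euclidean_space set"
  assumes "compact M" "smooth_submanifold N M"
  shows "\<exists>r>0. \<exists>A\<ge>0. \<forall>x\<in>M. \<forall>y\<in>M. dist x y < r \<longrightarrow> near_geodesic M A x y"
proof -
  have "\<forall>p\<in>M. \<exists>\<epsilon>>0. \<exists>A\<ge>0. \<forall>x\<in>M \<inter> ball p \<epsilon>. \<forall>y\<in>M \<inter> ball p \<epsilon>. near_geodesic M A x y"
    using smooth_submanifold_chart[OF assms(2)] slice_chart.local_geometry(1) by metis
  then obtain \<epsilon> A where \<epsilon>: "\<And>p. p \<in> M \<Longrightarrow> \<epsilon> p > 0"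
    and A: "\<And>p. p \<in> M \<Longrightarrow> A p \<ge> 0"
      "\<And>p x y. p \<in> M \<Longrightarrow> x \<in> M \<inter> ball p (\<epsilon> p) \<Longrightarrow> y \<in> M \<inter> ball p (\<epsilon> p) \<Longrightarrow> near_geodesic M (A p) x y"
    by metis
  have "M \<subseteq> (\<Union>p\<in>M. ball p (\<epsilon> p))" using \<epsilon> by force
  then obtain D where D: "D \<subseteq> M" "finite D" "M \<subseteq> (\<Union>p\<in>D. ball p (\<epsilon> p))"
    by (rule compactE_image[OF assms(1), rotated]) auto
  then have "M \<subseteq> \<Union> ((\<lambda>p. ball p (\<epsilon> p)) ` D)" by blast
  then obtain r where r: "r > 0" "\<And>x. x \<in> M \<Longrightarrow> \<exists>G\<in>(\<lambda>p. ball p (\<epsilon> p)) ` D. ball x r \<subseteq> G"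
    by (rule Heine_Borel_lemma[OF assms(1)]) auto
  have "near_geodesic M (\<Sum>p\<in>D. A p) x y" if xy: "x \<in> M" "y \<in> M" "dist x y < r" for x y
  proof -
    obtain p where p: "p \<in> D" "ball x r \<subseteq> ball p (\<epsilon> p)" using r(2)[OF xy(1)] by blast
    have "x \<in> ball p (\<epsilon> p)" "y \<in> ball p (\<epsilon> p)"
      using subsetD[OF p(2), of x] subsetD[OF p(2), of y] r(1) xy(3) by simp_all
    then have "near_geodesic M (A p) x y" using A(2) xy p D(1) by blast
    moreover have "A p \<le> (\<Sum>p\<in>D. A p)"
      by (rule member_le_sum) (use p D A in auto)
    ultimately show ?thesis by (rule near_geodesic_mono)
  qed
  moreover have "(\<Sum>p\<in>D. A p) \<ge> 0" using A(1) D(1) by (meson sum_nonneg subsetD)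
  ultimately show ?thesis using r(1) by blast
qed

lemma compact_submanifold_separated_card:
  fixes M :: "'a::euclidean_space set"
  assumes "compact M" "smooth_submanifold N M"
  shows "\<exists>C>0. \<forall>s E. 0 < s \<longrightarrow> s \<le> 1 \<longrightarrow> finite E \<longrightarrow> E \<subseteq> M \<longrightarrow>
           (\<forall>x\<in>E. \<forall>y\<in>E. x \<noteq> y \<longrightarrow> s \<le> dist x y) \<longrightarrow> real (card E) \<le> C * (1 / s) ^ N"
proof -
  have "\<forall>p\<in>M. \<exists>\<epsilon>>0. \<exists>C>0. \<forall>s E. 0 < s \<longrightarrow> s \<le> 1 \<longrightarrow> E \<subseteq> M \<inter> ball p \<epsilon> \<longrightarrow>
           (\<forall>x\<in>E. \<forall>y\<in>E. x \<noteq> y \<longrightarrow> s \<le> dist x y) \<longrightarrow> real (card E) \<le> C * (1 / s) ^ N"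
  proof
    fix p assume "p \<in> M"
    with assms(2) obtain U V S \<phi> \<psi> where "slice_chart N M U V S \<phi> \<psi>" "p \<in> U"
      by (rule smooth_submanifold_chart)
    then show "\<exists>\<epsilon>>0. \<exists>C>0. \<forall>s E. 0 < s \<longrightarrow> s \<le> 1 \<longrightarrow> E \<subseteq> M \<inter> ball p \<epsilon> \<longrightarrow>
           (\<forall>x\<in>E. \<forall>y\<in>E. x \<noteq> y \<longrightarrow> s \<le> dist x y) \<longrightarrow> real (card E) \<le> C * (1 / s) ^ N"
      using slice_chart.local_geometry(2)[of N M U V S \<phi> \<psi> p] \<open>p \<in> M\<close> by simp
  qed
  then obtain \<epsilon> where "\<forall>p\<in>M. \<epsilon> p > 0 \<and> (\<exists>C>0. \<forall>s E. 0 < s \<longrightarrow> s \<le> 1 \<longrightarrow> E \<subseteq> M \<inter> ball p (\<epsilon> p) \<longrightarrow>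
           (\<forall>x\<in>E. \<forall>y\<in>E. x \<noteq> y \<longrightarrow> s \<le> dist x y) \<longrightarrow> real (card E) \<le> C * (1 / s) ^ N)"
    unfolding bchoice_iff by blast
  then obtain C where \<epsilon>: "\<And>p. p \<in> M \<Longrightarrow> \<epsilon> p > 0"
    and C: "\<And>p. p \<in> M \<Longrightarrow> C p > 0"
      "\<And>p s E. p \<in> M \<Longrightarrow> 0 < s \<Longrightarrow> s \<le> 1 \<Longrightarrow> E \<subseteq> M \<inter> ball p (\<epsilon> p) \<Longrightarrow>
         \<forall>x\<in>E. \<forall>y\<in>E. x \<noteq> y \<longrightarrow> s \<le> dist x y \<Longrightarrow> real (card E) \<le> C p * (1 / s) ^ N"
    by metis
  have "M \<subseteq> (\<Union>p\<in>M. ball p (\<epsilon> p))" using \<epsilon> by force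
  then obtain D where D: "D \<subseteq> M" "finite D" "M \<subseteq> (\<Union>p\<in>D. ball p (\<epsilon> p))"
    by (rule compactE_image[OF assms(1), rotated]) auto
  \<comment> \<open>The added 1 keeps the constant positive when \<open>M\<close>, and so
    \<open>D\<close>, is empty.\<close>
  have "real (card E) \<le> ((\<Sum>p\<in>D. C p) + 1) * (1 / s) ^ N"
    if s: "0 < s" "s \<le> 1" and E: "finite E" "E \<subseteq> M"
      and sep: "\<forall>x\<in>E. \<forall>y\<in>E. x \<noteq> y \<longrightarrow> s \<le> dist x y" for s E
  proof -
    have "E = (\<Union>p\<in>D. E \<inter> ball p (\<epsilon> p))" using D E by blast
    then have "card E \<le> (\<Sum>p\<in>D. card (E \<inter> ball p (\<epsilon> p)))"
      using card_UN_le[OF D(2), of "\<lambda>p. E \<inter> ball p (\<epsilon> p)"] by simp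
    then have "real (card E) \<le> (\<Sum>p\<in>D. real (card (E \<inter> ball p (\<epsilon> p))))"
      by (metis of_nat_le_iff of_nat_sum)
    also have "\<dots> \<le> (\<Sum>p\<in>D. C p * (1 / s) ^ N)"
      by (intro sum_mono C(2)) (use D E s sep in auto)
    also have "\<dots> \<le> ((\<Sum>p\<in>D. C p) + 1) * (1 / s) ^ N"
      using s by (simp add: sum_distrib_right[symmetric] distrib_right)
    finally show ?thesis .
  qed
  moreover have "(\<Sum>p\<in>D. C p) + 1 > 0"
    using C D by (intro add_nonneg_pos sum_nonneg) (auto simp: less_imp_le subset_iff)
  ultimately show ?thesis by blast
qed

section \<open>Derivatives of iterates\<close>

text \<open>Restricting time to \<open>ball 0 e\<close> keeps the curve in \<open>M\<close>, within
  which \<open>g\<close> has its derivative, and does not change the filter at 0. Through this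
  formula the velocity of \<open>g \<circ> c\<close> determines a derivative within \<open>M\<close>
  on tangent vectors, although its values on other vectors may be arbitrary.\<close>

lemma tangent_curve_derivative:
  assumes "(c has_vector_derivative v) (at (0::real))" "e > 0" "\<And>t. \<bar>t\<bar> < e \<Longrightarrow> c t \<in> M"
    and "(g has_derivative D) (at (c 0) within M)"
  shows "((\<lambda>t. g (c t)) has_vector_derivative D v) (at 0)"
proof -
  have "(c has_derivative (\<lambda>h. h *\<^sub>R v)) (at 0 within ball 0 e)"
    using assms(1) by (auto simp: has_vector_derivative_def intro: has_derivative_at_withinI)
  moreover have "(g has_derivative D) (at (c 0) within c ` ball 0 e)"
    by (rule has_derivative_subset[OF assms(4)]) (use assms(3) in \<open>auto simp: dist_real_def\<close>)
  ultimately have "(g \<circ> c has_derivative D \<circ> (\<lambda>h. h *\<^sub>R v)) (at 0 within ball 0 e)"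
    by (rule diff_chain_within)
  moreover have "at (0::real) within ball 0 e = at 0"
    using \<open>e > 0\<close> by (intro at_within_open) auto
  ultimately show ?thesis
    using has_derivative_linear[OF assms(4)] by (simp add: has_vector_derivative_def o_def linear_cmul)
qed

lemma has_derivative_tangent_unique:
  assumes "v \<in> tangent_space M x"
    and "(g has_derivative D) (at x within M)" "(g has_derivative D') (at x within M)"
  shows "D v = D' v"
  using assms tangent_curve_derivative vector_derivative_unique_at
  unfolding tangent_space_def by (smt (verit, best) mem_Collect_eq)

lemma has_derivative_tangent_space:
  assumes "v \<in> tangent_space M x" "g ` M \<subseteq> M" "(g has_derivative D) (at x within M)"
  shows "D v \<in> tangent_space M (g x)"
proof -
  obtain c e where c: "e > 0" "\<And>t. \<bar>t\<bar> < e \<Longrightarrow> c t \<in> M" "c 0 = x"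
    "(c has_vector_derivative v) (at (0::real))"
    using assms(1) unfolding tangent_space_def by blast
  have "((\<lambda>t. g (c t)) has_vector_derivative D v) (at 0)"
    by (rule tangent_curve_derivative[OF c(4,1,2)]) (use c assms in auto)
  then show ?thesis
    unfolding tangent_space_def using c assms(2)
    by (intro CollectI exI[of _ "\<lambda>t. g (c t)"] exI[of _ e]) auto
qed

lemma mderiv_tangent:
  fixes M :: "'a::euclidean_space set"
  assumes "subspace (tangent_space M x)" "v \<in> tangent_space M x" "(g has_derivative D) (at x within M)"
  shows "mderiv M g x v = D v"
proof -
  have "(g has_derivative frechet_derivative g (at x within M)) (at x within M)"
    using assms(3) differentiableI frechet_derivative_works by blast
  then show ?thesis
    using has_derivative_tangent_unique[OF assms(2) _ assms(3)] orth_proj_id[OF assms(1,2)]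
    by (simp add: mderiv_def)
qed

lemma mderiv_orth_proj:
  fixes M :: "'a::euclidean_space set"
  assumes "subspace (tangent_space M x)"
  shows "mderiv M g x (orth_proj (tangent_space M x) v) = mderiv M g x v"
  using assms by (simp add: mderiv_def orth_proj_id orth_proj_in)

lemma mderiv_in_tangent_space:
  fixes M :: "'a::euclidean_space set"
  assumes "subspace (tangent_space M x)" "g ` M \<subseteq> M" "g differentiable (at x within M)"
  shows "mderiv M g x v \<in> tangent_space M (g x)"
  using assms has_derivative_tangent_space[OF orth_proj_in[OF assms(1)] assms(2)]
  by (simp add: mderiv_def frechet_derivative_works)

text \<open>\<open>mderiv\<close> inserts a projection between the two derivatives. It does no harm,
  since the derivative of \<open>g\<close> already sends tangent vectors to tangent vectors at the
  image point.\<close>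

lemma mderiv_comp:
  fixes M :: "'a::euclidean_space set"
  assumes "subspace (tangent_space M x)" "subspace (tangent_space M (g x))" "x \<in> M" "g ` M \<subseteq> M"
    and "g differentiable (at x within M)" "f differentiable (at (g x) within M)"
  shows "mderiv M (f \<circ> g) x v = mderiv M f (g x) (mderiv M g x v)"
proof -
  let ?w = "orth_proj (tangent_space M x) v"
  let ?D = "frechet_derivative g (at x within M)" and ?E = "frechet_derivative f (at (g x) within M)"
  have D: "(g has_derivative ?D) (at x within M)" "(f has_derivative ?E) (at (g x) within M)"
    using assms frechet_derivative_works by blast+
  then have "(f \<circ> g has_derivative ?E \<circ> ?D) (at x within M)"
    using assms(4) by (intro diff_chain_within) (auto intro: has_derivative_subset)
  then have "mderiv M (f \<circ> g) x ?w = ?E (?D ?w)"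
    using mderiv_tangent[OF assms(1) orth_proj_in[OF assms(1)]] by simp
  also have "\<dots> = mderiv M f (g x) (?D ?w)"
    using mderiv_tangent[OF assms(2) has_derivative_tangent_space[OF orth_proj_in[OF assms(1)] assms(4) D(1)] D(2)]
    by simp
  finally show ?thesis
    using mderiv_orth_proj[OF assms(1), of "f \<circ> g" v] by (simp add: mderiv_def)
qed

text \<open>This isolates what the estimates use of \<open>M_const\<close>: one number bounding both
  the derivative and its Hoelder constant, with \<open>2 \<le> B powr \<rho>\<close> inherited from
  the entry \<open>2 powr (1 / \<rho>)\<close>. The suprema in the norm thus stay out of the
  induction.\<close>

locale C1_Holder_map =
  fixes M :: "'a::euclidean_space set" and f :: "'a \<Rightarrow> 'a" and \<rho> B :: real
  assumes subspace_tangent: "x \<in> M \<Longrightarrow> subspace (tangent_space M x)"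
    and maps: "f ` M \<subseteq> M" and diff: "f differentiable_on M"
    and \<rho>_pos: "0 < \<rho>" and B_ge_1: "1 \<le> B" and B_powr: "2 \<le> B powr \<rho>"
    and deriv_le: "x \<in> M \<Longrightarrow> norm (mderiv M f x v) \<le> B * norm v"
    and deriv_Holder: "x \<in> M \<Longrightarrow> y \<in> M \<Longrightarrow>
      norm (mderiv M f x v - mderiv M f y v) \<le> B * dist x y powr \<rho> * norm v"
begin

lemma iter_in: "x \<in> M \<Longrightarrow> (f ^^ n) x \<in> M"
  using maps by (induction n) auto

lemma iter_diff: "x \<in> M \<Longrightarrow> (f ^^ n) differentiable (at x within M)"
proof (induction n)
  case 0
  then show ?case by (simp add: id_def)
next
  case (Suc n)
  have "f differentiable (at ((f ^^ n) x) within (f ^^ n) ` M)"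
    using diff iter_in Suc by (auto simp: differentiable_on_def intro: differentiable_within_subset)
  then show ?case
    using Suc differentiable_chain_within by (simp add: o_def)
qed

lemma mderiv_iter_Suc:
  "x \<in> M \<Longrightarrow> mderiv M (f ^^ Suc n) x v = mderiv M f ((f ^^ n) x) (mderiv M (f ^^ n) x v)"
  using mderiv_comp[of M x "f ^^ n" f v] subspace_tangent iter_in iter_diff diff
  by (auto simp: differentiable_on_def)

lemma linear_mderiv_iter: "x \<in> M \<Longrightarrow> linear (mderiv M (f ^^ n) x)"
  using bounded_linear_mderiv subspace_tangent iter_diff bounded_linear.linear by blast

lemma norm_mderiv_iter_le:
  assumes "x \<in> M"
  shows "norm (mderiv M (f ^^ n) x v) \<le> B ^ n * norm v"
proof (induction n)
  case 0
  have "((\<lambda>x. x) has_derivative (\<lambda>x. x)) (at x within M)" by (rule has_derivative_ident)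
  then have "mderiv M id x v = orth_proj (tangent_space M x) v"
    using mderiv_tangent[OF subspace_tangent[OF assms] orth_proj_in[OF subspace_tangent[OF assms]]]
      mderiv_orth_proj[OF subspace_tangent[OF assms]] by (metis eq_id_iff)
  then show ?case using norm_orth_proj_le[OF subspace_tangent[OF assms]] by (simp add: id_def)
next
  case (Suc n)
  have "norm (mderiv M (f ^^ Suc n) x v) \<le> B * norm (mderiv M (f ^^ n) x v)"
    using mderiv_iter_Suc deriv_le iter_in assms by simp
  also have "\<dots> \<le> B * (B ^ n * norm v)"
    using Suc B_ge_1 by (intro mult_left_mono) auto
  finally show ?case by (simp add: mult.assoc del: funpow.simps)
qed

text \<open>The base is \<open>n = 1\<close>, since \<open>mderiv M id x\<close> is the projection \<open>\<Pi>_x\<close>, whose dependence on \<open>x\<close>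
  is not controlled by \<open>B\<close>. The assumption \<open>2 \<le> B powr \<rho>\<close> absorbs the sum over the iterates.\<close>

lemma mderiv_iter_Holder:
  assumes x: "x \<in> M" "y \<in> M" and "l \<ge> 0"
    and close: "\<And>i. dist ((f ^^ i) x) ((f ^^ i) y) \<le> B ^ i * l"
  shows "norm (mderiv M (f ^^ Suc n) x v - mderiv M (f ^^ Suc n) y v)
           \<le> B ^ Suc n * (B powr \<rho>) ^ Suc n * l powr \<rho> * norm v"
proof (induction n)
  case 0
  have "norm (mderiv M f x v - mderiv M f y v) \<le> B * dist x y powr \<rho> * norm v"
    using deriv_Holder x by blast
  also have "\<dots> \<le> B * (B powr \<rho> * l powr \<rho>) * norm v"
  proof (intro mult_right_mono mult_left_mono)
    have "dist x y powr \<rho> \<le> l powr \<rho>"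
      using close[of 0] \<rho>_pos by (intro powr_mono2) auto
    also have "\<dots> \<le> B powr \<rho> * l powr \<rho>" using B_powr by (simp add: mult_le_cancel_right1)
    finally show "dist x y powr \<rho> \<le> B powr \<rho> * l powr \<rho>" .
  qed (use B_ge_1 in auto)
  finally show ?case by (simp add: mult_ac)
next
  case (Suc n)
  let ?n = "Suc n"
  let ?x = "(f ^^ ?n) x" and ?y = "(f ^^ ?n) y"
  let ?Q = "B * (B ^ ?n * (B powr \<rho>) ^ ?n * l powr \<rho> * norm v)"
  have in_M: "?x \<in> M" "?y \<in> M" using x iter_in by blast+
  have lin: "linear (mderiv M f ?x)" using linear_mderiv_iter[of ?x 1] in_M by simp
  \<comment> \<open>Of the two errors, the first is inherited from the previous iterate and
    stretched by one more derivative; the second comes from moving the base point of the last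
    derivative. Each is at most \<open>?Q\<close>.\<close>
  have "mderiv M (f ^^ Suc ?n) x v - mderiv M (f ^^ Suc ?n) y v
     = mderiv M f ?x (mderiv M (f ^^ ?n) x v - mderiv M (f ^^ ?n) y v)
       + (mderiv M f ?x (mderiv M (f ^^ ?n) y v) - mderiv M f ?y (mderiv M (f ^^ ?n) y v))"
    by (simp only: mderiv_iter_Suc[OF x(1), of ?n] mderiv_iter_Suc[OF x(2), of ?n] linear_diff[OF lin]) simp
  also have "norm \<dots> \<le> ?Q + ?Q"
  proof (rule norm_triangle_le[OF add_mono])
    show "norm (mderiv M f ?x (mderiv M (f ^^ ?n) x v - mderiv M (f ^^ ?n) y v)) \<le> ?Q"
      by (rule order_trans[OF deriv_le[OF in_M(1)]]) (use Suc B_ge_1 in \<open>simp del: funpow.simps add: mult_left_mono\<close>)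
    have "dist ?x ?y powr \<rho> \<le> (B ^ ?n * l) powr \<rho>"
      using close[of ?n] \<rho>_pos by (intro powr_mono2) auto
    also have "\<dots> = (B powr \<rho>) ^ ?n * l powr \<rho>"
      using B_ge_1 \<open>l \<ge> 0\<close> by (simp add: powr_mult powr_powr powr_realpow[symmetric] mult.commute del: power_Suc)
    finally have d: "dist ?x ?y powr \<rho> \<le> (B powr \<rho>) ^ ?n * l powr \<rho>" .
    have "norm (mderiv M f ?x (mderiv M (f ^^ ?n) y v) - mderiv M f ?y (mderiv M (f ^^ ?n) y v))
        \<le> B * dist ?x ?y powr \<rho> * norm (mderiv M (f ^^ ?n) y v)"
      by (rule deriv_Holder[OF in_M])
    also have "\<dots> \<le> B * ((B powr \<rho>) ^ ?n * l powr \<rho>) * (B ^ ?n * norm v)"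
      using B_ge_1 by (intro mult_mono mult_left_mono d norm_mderiv_iter_le x) auto
    finally show "norm (mderiv M f ?x (mderiv M (f ^^ ?n) y v) - mderiv M f ?y (mderiv M (f ^^ ?n) y v)) \<le> ?Q"
      by (simp add: mult_ac)
  qed
  also have "\<dots> = 2 * ?Q" by simp
  also have "\<dots> \<le> B powr \<rho> * ?Q"
    using B_powr B_ge_1 by (intro mult_right_mono) auto
  finally show ?case by (simp add: mult_ac del: funpow.simps)
qed

lemma iter_curve_derivative:
  assumes "c t \<in> M" "c' \<in> tangent_space M (c t)" "(c has_vector_derivative c') (at t within T)" "c ` T \<subseteq> M"
  shows "((\<lambda>t. (f ^^ n) (c t)) has_vector_derivative mderiv M (f ^^ n) (c t) c') (at t within T)"
proof -
  let ?D = "frechet_derivative (f ^^ n) (at (c t) within M)"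
  have D: "((f ^^ n) has_derivative ?D) (at (c t) within M)"
    using iter_diff[OF assms(1)] frechet_derivative_works by blast
  then have "((f ^^ n) \<circ> c has_derivative ?D \<circ> (\<lambda>h. h *\<^sub>R c')) (at t within T)"
    using assms by (intro diff_chain_within) (auto simp: has_vector_derivative_def intro: has_derivative_subset)
  then show ?thesis
    using has_derivative_linear[OF D] mderiv_tangent[OF subspace_tangent[OF assms(1)] assms(2) D]
    by (simp add: has_vector_derivative_def o_def linear_cmul)
qed

lemma periodic_pair_estimate:
  fixes A :: real and n :: nat
  assumes "near_geodesic M A x y" and "n \<ge> 1" "(f ^^ n) x = x" "(f ^^ n) y = y" and "A \<ge> 0"
  defines "w \<equiv> orth_proj (tangent_space M x) (y - x)"
  defines "l \<equiv> (1 + A * dist x y) * norm w"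
  shows "norm (mderiv M (f ^^ n) x w - w) \<le> B ^ n * (B powr \<rho>) ^ n * l powr \<rho> * l"
proof -
  obtain c c' where c: "c 0 = x" "c 1 = y"
    and cM: "\<And>t::real. t \<in> {0..1} \<Longrightarrow> c t \<in> M"
    and c'T: "\<And>t::real. t \<in> {0..1} \<Longrightarrow> c' t \<in> tangent_space M (c t)"
    and cd: "\<And>t. t \<in> {0..1} \<Longrightarrow> (c has_vector_derivative c' t) (at t within {0..1})"
    and speed: "\<And>t. t \<in> {0..1} \<Longrightarrow> norm (c' t) \<le> l"
    using assms(1) unfolding near_geodesic_def l_def w_def by blast
  have "l \<ge> 0" using \<open>A \<ge> 0\<close> by (simp add: l_def)
  have xM: "x \<in> M" using cM[of 0] c by simp
  let ?T = "tangent_space M x"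
  have T: "subspace ?T" using subspace_tangent xM by blast
  have dF: "((\<lambda>t. (f ^^ i) (c t)) has_vector_derivative mderiv M (f ^^ i) (c t) (c' t)) (at t within {0..1})"
    if "t \<in> {0..1}" for i t
    by (rule iter_curve_derivative) (use that cM c'T cd in auto)
  \<comment> \<open>The bound is taken along the curve: \<open>f ^^ i\<close> maps it to a curve of
    speed at most \<open>B ^ i * l\<close>. A derivative bound on \<open>M\<close> alone would not
    make \<open>f\<close> a \<open>B\<close>-Lipschitz map for the ambient distance.\<close>
  have close: "dist ((f ^^ i) (c s)) ((f ^^ i) x) \<le> B ^ i * l" if s: "s \<in> {0..1}" for i s
  proof -
    have "norm ((f ^^ i) (c s) - (f ^^ i) (c 0)) \<le> B ^ i * l * norm (s - 0)"
    proof (rule differentiable_bound[of "{0..1}" "\<lambda>t. (f ^^ i) (c t)"])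
      fix t :: real assume t: "t \<in> {0..1}"
      show "((\<lambda>t. (f ^^ i) (c t)) has_derivative (\<lambda>h. h *\<^sub>R mderiv M (f ^^ i) (c t) (c' t))) (at t within {0..1})"
        using dF[OF t] by (simp add: has_vector_derivative_def)
      have "norm (mderiv M (f ^^ i) (c t) (c' t)) \<le> B ^ i * norm (c' t)"
        using norm_mderiv_iter_le cM t by blast
      also have "\<dots> \<le> B ^ i * l" using speed[OF t] B_ge_1 by (intro mult_left_mono) auto
      finally show "onorm (\<lambda>h. h *\<^sub>R mderiv M (f ^^ i) (c t) (c' t)) \<le> B ^ i * l"
        by (intro onorm_le) (simp add: mult.commute mult_left_mono)
    qed (use s in auto)
    also have "\<dots> \<le> B ^ i * l" using s \<open>l \<ge> 0\<close> B_ge_1 by (simp add: mult_left_le)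
    finally show ?thesis using c by (simp add: dist_norm)
  qed
  let ?L = "mderiv M (f ^^ n) x" and ?K = "B ^ n * (B powr \<rho>) ^ n * l powr \<rho>"
  have K: "?K \<ge> 0" using B_ge_1 by simp
  have linL: "bounded_linear ?L" using bounded_linear_mderiv[OF T iter_diff[OF xM]] .
  obtain m where m: "n = Suc m" using \<open>n \<ge> 1\<close> by (cases n) auto
  \<comment> \<open>Subtracting the derivative frozen at \<open>x\<close> leaves a curve whose
    velocity is \<open>df^n(c t) - df^n(x)\<close> applied to \<open>c' t\<close>, which the Hoelder
    bound controls.\<close>
  have "norm (((f ^^ n) (c 1) - ?L (c 1)) - ((f ^^ n) (c 0) - ?L (c 0))) \<le> ?K * l * norm (1 - (0::real))"
  proof (rule differentiable_bound[of "{0..1}" "\<lambda>t. (f ^^ n) (c t) - ?L (c t)"])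
    fix t :: real assume t: "t \<in> {0..1}"
    let ?d = "mderiv M (f ^^ n) (c t) (c' t) - ?L (c' t)"
    show "((\<lambda>t. (f ^^ n) (c t) - ?L (c t)) has_derivative (\<lambda>h. h *\<^sub>R ?d)) (at t within {0..1})"
      using has_vector_derivative_diff[OF dF[OF t] bounded_linear.has_vector_derivative[OF linL cd[OF t]]]
      by (simp add: has_vector_derivative_def)
    have "norm ?d \<le> ?K * norm (c' t)"
      unfolding m using mderiv_iter_Holder[OF cM[OF t] xM \<open>l \<ge> 0\<close> close[OF t]] .
    also have "\<dots> \<le> ?K * l" using speed[OF t] K by (intro mult_left_mono)
    finally show "onorm (\<lambda>h. h *\<^sub>R ?d) \<le> ?K * l"
      by (intro onorm_le) (simp add: mult.commute mult_left_mono)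
  qed auto
  moreover have "((f ^^ n) (c 1) - ?L (c 1)) - ((f ^^ n) (c 0) - ?L (c 0)) = (y - x) - ?L (y - x)"
    using assms(3,4) c linear_diff[OF bounded_linear.linear[OF linL]] by (simp add: algebra_simps)
  ultimately have "norm ((y - x) - ?L (y - x)) \<le> ?K * l" by simp
  \<comment> \<open>As \<open>f ^^ n\<close> fixes \<open>x\<close>, \<open>?L\<close> takes values
    in the tangent space at \<open>x\<close> and depends only on the tangential part of its
    argument. Projecting therefore replaces \<open>y - x\<close> by \<open>w\<close> throughout
    without enlarging the norm.\<close>
  moreover have "orth_proj ?T ((y - x) - ?L (y - x)) = w - ?L w"
  proof -
    have "?L (y - x) \<in> ?T"
      using mderiv_in_tangent_space[OF T _ iter_diff[OF xM]] iter_in assms(3) by (metis image_subsetI)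
    then have "orth_proj ?T ((y - x) - ?L (y - x)) = w - ?L (y - x)"
      unfolding w_def by (subst linear_diff[OF linear_orth_proj[OF T]]) (simp add: orth_proj_id[OF T])
    then show ?thesis using mderiv_orth_proj[OF T] by (simp add: w_def)
  qed
  ultimately have "norm (w - ?L w) \<le> ?K * l"
    using norm_orth_proj_le[OF T, of "(y - x) - ?L (y - x)"] by simp
  then show ?thesis by (simp add: norm_minus_commute)
qed

end

section \<open>Hyperbolicity and separation of periodic points\<close>

lemma Re_vec_of_real: "Re_vec (\<chi> i. complex_of_real (u $ i)) = u"
  and Im_vec_of_real: "Im_vec (\<chi> i. complex_of_real (u $ i)) = 0"
  by (simp_all add: Re_vec_def Im_vec_def vec_eq_iff)

lemma norm_vec_of_real: "norm (\<chi> i. complex_of_real ((u :: real ^ 'd) $ i)) = norm u"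
  by (simp add: norm_vec_def)

text \<open>The angle \<open>\<phi> = 0\<close> and the real unit vector \<open>w / norm w\<close>
  are admissible in the infimum, and real vectors keep their norm under complexification.\<close>

lemma hyperbolicity_le:
  fixes T :: "(real ^ 'd) set"
  assumes T: "subspace T" and L: "linear L" and w: "w \<in> T" "w \<noteq> 0"
  shows "hyperbolicity T L \<le> ereal (norm (L w - w) / norm w)"
proof -
  define u where "u = w /\<^sub>R norm w"
  define v :: "complex ^ 'd" where "v = (\<chi> i. complex_of_real (u $ i))"
  have "u \<in> T" "norm u = 1" using T w by (auto simp: u_def subspace_scale)
  then have "v \<in> {v \<in> complexify_space T. norm v = 1}"
    using subspace_0[OF T]
    by (simp add: v_def complexify_space_def Re_vec_of_real Im_vec_of_real norm_vec_of_real)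
  then have "hyperbolicity T L \<le> ereal (norm (complexify_map L v
      - exp (2 * complex_of_real pi * \<i> * complex_of_real 0) *s v))"
    unfolding hyperbolicity_def by (intro INF_lower2[of 0] INF_lower) auto
  also have "complexify_map L v - exp (2 * complex_of_real pi * \<i> * complex_of_real 0) *s v
      = (\<chi> i. complex_of_real ((L u - u) $ i))"
    using linear_0[OF L]
    by (simp add: complexify_map_def v_def Re_vec_of_real Im_vec_of_real vec_eq_iff complex_eq_iff)
  also have "norm \<dots> = norm (L u - u)" by (rule norm_vec_of_real)
  also have "L u - u = (L w - w) /\<^sub>R norm w"
    by (simp add: u_def linear_cmul[OF L] scaleR_diff_right)
  finally show ?thesis by (simp add: divide_inverse mult.commute)
qed

text \<open>On the compact product of the closed interval \<open>{0..1}\<close> with the unit sphere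
  a minimum is attained, and a zero minimum would exhibit an eigenvalue of modulus 1. With no unit
  vectors the infimum is \<open>\<infinity>\<close>.\<close>

lemma hyperbolicity_pos:
  fixes T :: "(real ^ 'd) set"
  assumes T: "subspace T" and L: "linear L"
    and hyp: "\<And>z. complex_eigenvalue T L z \<Longrightarrow> cmod z \<noteq> 1"
  shows "hyperbolicity T L > 0"
proof -
  define E :: "real \<Rightarrow> complex" where "E = (\<lambda>\<phi>. exp (2 * complex_of_real pi * \<i> * complex_of_real \<phi>))"
  define S where "S = {v \<in> complexify_space T. norm v = 1}"
  define F where "F = (\<lambda>p :: real \<times> (complex ^ 'd). norm (complexify_map L (snd p) - E (fst p) *s snd p))"
  have cont_Re: "continuous_on A Re_vec" and cont_Im: "continuous_on A Im_vec" for A :: "(complex ^ 'd) set"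
    unfolding Re_vec_def[abs_def] Im_vec_def[abs_def] by (intro continuous_intros)+
  have "closed (Re_vec -` T)" "closed (Im_vec -` T)"
    by (intro closed_vimage closed_subspace[OF T] cont_Re cont_Im)+
  moreover have "S = Re_vec -` T \<inter> Im_vec -` T \<inter> sphere 0 1"
    by (auto simp: S_def complexify_space_def)
  ultimately have "compact S" by (simp add: compact_Int_closed closed_Int closed_Int_compact)
  then have cpt: "compact ({0..1::real} \<times> S)" by (intro compact_Times) auto
  have cont: "continuous_on ({0..1} \<times> S) F"
  proof -
    have cL: "continuous_on UNIV L" using L by (simp add: linear_continuous_on linear_linear)
    have "continuous_on A (\<lambda>p. L (Re_vec (snd p)))" "continuous_on A (\<lambda>p. L (Im_vec (snd p)))"
      for A :: "(real \<times> (complex ^ 'd)) set"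
      by (rule continuous_on_compose2[OF cL continuous_on_compose2[OF cont_Re[of UNIV]]]
            continuous_on_compose2[OF cL continuous_on_compose2[OF cont_Im[of UNIV]]],
          rule continuous_on_snd[OF continuous_on_id], rule subset_UNIV, rule subset_UNIV)+
    then show ?thesis
      unfolding F_def complexify_map_def E_def vector_scalar_mult_def Complex_eq
      by (intro continuous_intros)
  qed
  show ?thesis
  proof (cases "S = {}")
    case True
    then show ?thesis unfolding hyperbolicity_def S_def[symmetric] by (simp add: top_ereal_def)
  next
    case False
    then obtain p where p: "p \<in> {0..1} \<times> S" "\<And>q. q \<in> {0..1} \<times> S \<Longrightarrow> F p \<le> F q"
      using continuous_attains_inf[OF cpt _ cont] by auto
    have "F p \<noteq> 0"
    proof
      assume "F p = 0"
      then have "complexify_map L (snd p) = E (fst p) *s snd p" by (simp add: F_def)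
      moreover have "snd p \<in> complexify_space T" "snd p \<noteq> 0" using p(1) by (auto simp: S_def)
      ultimately have "complex_eigenvalue T L (E (fst p))"
        unfolding complex_eigenvalue_def by blast
      moreover have "cmod (E (fst p)) = 1" by (simp add: E_def)
      ultimately show False using hyp by blast
    qed
    then have "F p > 0" by (simp add: F_def)
    moreover have "ereal (F p) \<le> hyperbolicity T L"
      unfolding hyperbolicity_def S_def[symmetric]
    proof (intro INF_greatest)
      fix \<phi> :: real and v assume "\<phi> \<in> {0..<1}" "v \<in> S"
      then show "ereal (F p) \<le> ereal (norm (complexify_map L v
          - exp (2 * complex_of_real pi * \<i> * complex_of_real \<phi>) *s v))"
        using p(2)[of "(\<phi>, v)"] by (simp add: F_def E_def)
    qed
    ultimately show ?thesis by (meson ereal_less(2) less_le_trans)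
  qed
qed

text \<open>A real \<open>SUP\<close> is an upper bound only if the family is bounded. For the
  Hoelder quotients this is the constant \<open>K\<close> of \<open>C1_Holder\<close>; for the
  operator norms it follows by comparison with one base point, as \<open>M\<close> has finite
  diameter.\<close>

lemma C1_Holder_map_M_const:
  fixes M :: "'a::euclidean_space set"
  assumes "compact M" and sub: "\<And>x. x \<in> M \<Longrightarrow> subspace (tangent_space M x)"
    and "f ` M \<subseteq> M" and f: "C1_Holder \<rho> M f" and "0 < \<rho>"
  shows "C1_Holder_map M f \<rho> (M_const \<rho> M f)"
proof
  let ?B = "M_const \<rho> M f" and ?D = "mderiv M f"
  obtain K where K: "\<And>x y. x \<in> M \<Longrightarrow> y \<in> M \<Longrightarrow> onorm (\<lambda>v. ?D x v - ?D y v) \<le> K * dist x y powr \<rho>"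
    and diff: "f differentiable_on M"
    using f unfolding C1_Holder_def by blast
  show "f differentiable_on M" by fact
  have lin: "bounded_linear (?D x)" if "x \<in> M" for x
    using bounded_linear_mderiv[OF sub[OF that]] diff that by (simp add: differentiable_on_def)
  have lin2: "bounded_linear (\<lambda>v. ?D x v - ?D y v)" if "x \<in> M" "y \<in> M" for x y
    using lin that by (intro bounded_linear_sub)
  have "2 powr (1 / \<rho>) \<le> ?B" by (simp add: M_const_def)
  then have "(2 powr (1 / \<rho>)) powr \<rho> \<le> ?B powr \<rho>"
    using \<open>0 < \<rho>\<close> by (intro powr_mono2) auto
  then show "2 \<le> ?B powr \<rho>" using \<open>0 < \<rho>\<close> by (simp add: powr_powr)
  show "1 \<le> ?B"
    using \<open>2 powr (1 / \<rho>) \<le> ?B\<close> ge_one_powr_ge_zero[of 2 "1 / \<rho>"] \<open>0 < \<rho>\<close> by simp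
  have onorm_le: "onorm (?D x) \<le> ?B" if "x \<in> M" for x
  proof -
    obtain R where R: "\<And>y. y \<in> M \<Longrightarrow> dist y x \<le> R"
      using compact_imp_bounded[OF \<open>compact M\<close>] by (metis bounded_any_center dist_commute)
    have "onorm (?D y) \<le> \<bar>K\<bar> * R powr \<rho> + onorm (?D x)" if "y \<in> M" for y
    proof -
      have "onorm (?D y) = onorm (\<lambda>v. (?D y v - ?D x v) + ?D x v)" by simp
      also have "\<dots> \<le> onorm (\<lambda>v. ?D y v - ?D x v) + onorm (?D x)"
        by (rule onorm_triangle) (use lin lin2 that \<open>x \<in> M\<close> in auto)
      also have "onorm (\<lambda>v. ?D y v - ?D x v) \<le> K * dist y x powr \<rho>" using K that \<open>x \<in> M\<close> by blast
      also have "\<dots> \<le> \<bar>K\<bar> * R powr \<rho>"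
        using R[OF that] \<open>0 < \<rho>\<close> by (intro mult_mono powr_mono2) auto
      finally show ?thesis by simp
    qed
    then have "bdd_above ((\<lambda>x. onorm (?D x)) ` M)" by (rule bdd_aboveI2)
    then have "onorm (?D x) \<le> (SUP x\<in>M. onorm (?D x))" by (rule cSUP_upper[OF that])
    then show ?thesis by (simp add: M_const_def C1_Holder_norm_def)
  qed
  show "norm (?D x v) \<le> ?B * norm v" if "x \<in> M" for x v
    using onorm[OF lin[OF that], of v] onorm_le[OF that] by (meson mult_right_mono norm_ge_zero order_trans)
  show "norm (?D x v - ?D y v) \<le> ?B * dist x y powr \<rho> * norm v" if xy: "x \<in> M" "y \<in> M" for x y v
  proof (cases "x = y")
    case False
    let ?h = "\<lambda>(x, y). onorm (\<lambda>v. ?D x v - ?D y v) / dist x y powr \<rho>"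
    have "?h p \<le> \<bar>K\<bar>" if "p \<in> M \<times> M" for p
    proof (cases p)
      case (Pair x y)
      have "onorm (\<lambda>v. ?D x v - ?D y v) \<le> K * dist x y powr \<rho>"
        using K that Pair by simp
      also have "\<dots> \<le> \<bar>K\<bar> * dist x y powr \<rho>" by (intro mult_right_mono) auto
      finally have "onorm (\<lambda>v. ?D x v - ?D y v) \<le> \<bar>K\<bar> * dist x y powr \<rho>" .
      then show ?thesis using Pair by (cases "x = y") (auto simp: divide_le_eq)
    qed
    then have "bdd_above (?h ` (M \<times> M))" by (rule bdd_aboveI2)
    then have "?h (x, y) \<le> (SUP p\<in>M \<times> M. ?h p)" by (rule cSUP_upper[rotated]) (use xy in auto)
    then have "?h (x, y) \<le> ?B" by (simp add: M_const_def C1_Holder_norm_def)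
    then have "onorm (\<lambda>v. ?D x v - ?D y v) \<le> ?B * dist x y powr \<rho>"
      using False by (simp add: divide_le_eq)
    then show ?thesis
      using onorm[OF lin2[OF xy], of v] by (meson mult_right_mono norm_ge_zero order_trans)
  qed simp
qed (use assms in auto)

section \<open>Separation and finiteness of periodic points\<close>

lemma near_geodesic_dist_le:
  assumes "near_geodesic M A x y"
  shows "dist x y \<le> (1 + A * dist x y) * norm (orth_proj (tangent_space M x) (y - x))" (is "_ \<le> ?l")
proof -
  obtain c c' where c: "c 0 = x" "c 1 = y"
    and cd: "\<And>t. t \<in> {0..1} \<Longrightarrow> (c has_vector_derivative c' t) (at t within {0..1})"
    and speed: "\<And>t::real. t \<in> {0..1} \<Longrightarrow> norm (c' t) \<le> ?l"
    using assms unfolding near_geodesic_def by blast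
  have "norm (c 1 - c 0) \<le> ?l * norm (1 - (0::real))"
  proof (rule differentiable_bound[of "{0..1}" c])
    fix t :: real assume t: "t \<in> {0..1}"
    show "(c has_derivative (\<lambda>h. h *\<^sub>R c' t)) (at t within {0..1})"
      using cd[OF t] by (simp add: has_vector_derivative_def)
    show "onorm (\<lambda>h. h *\<^sub>R c' t) \<le> ?l"
      using speed[OF t] by (intro onorm_le) (metis mult.commute mult_left_mono norm_ge_zero norm_scaleR real_norm_def)
  qed auto
  then show ?thesis using c by (simp add: dist_norm norm_minus_commute)
qed

text \<open>The square collects two distortions: one factor is the quotient
  \<open>l / norm w\<close>, the other bounds \<open>(1 + A * d) powr \<rho>\<close>, using
  \<open>\<rho> \<le> 1\<close>.\<close>

lemma gamma_point_pair_le: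
  fixes M :: "(real ^ 'd) set"
  assumes "C1_Holder_map M f \<rho> B" "\<rho> \<le> 1"
    and "near_geodesic M A x y" "A \<ge> 0" "n \<ge> 1"
    and x: "x \<in> periodic_points M f n" and y: "y \<in> periodic_points M f n" and "x \<noteq> y"
  shows "gamma_point n M f x \<le> ereal (B ^ n * (B powr \<rho>) ^ n * (1 + A * dist x y)\<^sup>2 * dist x y powr \<rho>)"
proof -
  interpret C1_Holder_map M f \<rho> B by fact
  let ?T = "tangent_space M x" and ?L = "mderiv M (f ^^ n) x" and ?K = "B ^ n * (B powr \<rho>) ^ n"
  define w where "w = orth_proj ?T (y - x)"
  define d where "d = dist x y"
  define l where "l = (1 + A * d) * norm w"
  have xM: "x \<in> M" using x by (simp add: periodic_points_def)
  have T: "subspace ?T" by (rule subspace_tangent[OF xM])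
  have d: "d > 0" using \<open>x \<noteq> y\<close> by (simp add: d_def)
  have a: "1 + A * d \<ge> 1" using \<open>A \<ge> 0\<close> d by simp
  \<comment> \<open>The chord is no longer than the curve, so the tangential part of
    \<open>y - x\<close> cannot vanish for distinct points.\<close>
  have "d \<le> l" using near_geodesic_dist_le[OF assms(3)] by (simp add: d_def l_def w_def)
  then have "w \<noteq> 0" using d by (auto simp: l_def)
  have "norm w \<le> d"
    using norm_orth_proj_le[OF T, of "y - x"] by (simp add: w_def d_def dist_norm norm_minus_commute)
  have "l \<le> (1 + A * d) * d" unfolding l_def using \<open>norm w \<le> d\<close> a by (intro mult_left_mono) auto
  then have "l powr \<rho> \<le> ((1 + A * d) * d) powr \<rho>"
    using \<open>d \<le> l\<close> d \<rho>_pos by (intro powr_mono2) auto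
  also have "\<dots> = (1 + A * d) powr \<rho> * d powr \<rho>" using a d by (simp add: powr_mult)
  also have "\<dots> \<le> (1 + A * d) powr 1 * d powr \<rho>"
    using a \<open>\<rho> \<le> 1\<close> by (intro mult_right_mono powr_mono) auto
  finally have lp: "l powr \<rho> \<le> (1 + A * d) * d powr \<rho>" using a by simp
  have "gamma_point n M f x \<le> ereal (norm (?L w - w) / norm w)"
    unfolding gamma_point_def
    by (rule hyperbolicity_le[OF T linear_mderiv_iter[OF xM] _ \<open>w \<noteq> 0\<close>])
       (simp add: w_def orth_proj_in[OF T])
  also have "norm (?L w - w) / norm w \<le> ?K * l powr \<rho> * l / norm w"
    using periodic_pair_estimate[OF assms(3) \<open>n \<ge> 1\<close> _ _ \<open>A \<ge> 0\<close>] x y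
    by (intro divide_right_mono) (auto simp: periodic_points_def w_def l_def d_def)
  also have "?K * l powr \<rho> * l / norm w = ?K * l powr \<rho> * (1 + A * d)"
    using \<open>w \<noteq> 0\<close> by (simp add: l_def)
  also have "\<dots> \<le> ?K * ((1 + A * d) * d powr \<rho>) * (1 + A * d)"
    using lp a B_ge_1 by (intro mult_right_mono mult_left_mono) auto
  finally show ?thesis by (simp add: d_def power2_eq_square mult_ac)
qed

lemma gamma_point_pos:
  fixes M :: "(real ^ 'd) set"
  assumes "C1_Holder_map M f \<rho> B" "only_hyperbolic_periodic_points M f" "n \<ge> 1"
    and x: "x \<in> periodic_points M f n"
  shows "gamma_point n M f x > 0"
proof -
  interpret C1_Holder_map M f \<rho> B by fact
  have "x \<in> M" using x by (simp add: periodic_points_def)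
  then show ?thesis
    unfolding gamma_point_def using assms(2,3) x
    by (intro hyperbolicity_pos subspace_tangent linear_mderiv_iter)
       (auto simp: only_hyperbolic_periodic_points_def hyperbolic_point_def)
qed

text \<open>A single nonzero tangent vector makes the hyperbolicity finite; the crude bound is what
  \<open>separation_scale_le\<close> asks of \<open>g\<close>.\<close>

lemma gamma_point_le:
  fixes M :: "(real ^ 'd) set"
  assumes "C1_Holder_map M f \<rho> B" "x \<in> M" "v \<in> tangent_space M x" "v \<noteq> 0"
  shows "gamma_point n M f x \<le> ereal (B ^ n + 1)"
proof -
  interpret C1_Holder_map M f \<rho> B by fact
  let ?L = "mderiv M (f ^^ n) x"
  have "gamma_point n M f x \<le> ereal (norm (?L v - v) / norm v)"
    unfolding gamma_point_def using assms by (intro hyperbolicity_le subspace_tangent linear_mderiv_iter)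
  also have "norm (?L v - v) \<le> (B ^ n + 1) * norm v"
    using norm_triangle_ineq4[of "?L v" v] norm_mderiv_iter_le[OF \<open>x \<in> M\<close>, of n v]
    by (simp add: distrib_right)
  then have "norm (?L v - v) / norm v \<le> B ^ n + 1" using \<open>v \<noteq> 0\<close> by (simp add: divide_le_eq)
  finally show ?thesis by simp
qed

text \<open>Infinitely many solutions would accumulate at a point \<open>p\<close> that is itself
  periodic, the set being closed. Hyperbolicity at \<open>p\<close> alone then contradicts the pair
  estimate for solutions close to \<open>p\<close>, so no lower bound uniform in the points is
  required.\<close>

lemma finite_periodic_points:
  fixes M :: "(real ^ 'd) set"
  assumes fH: "C1_Holder_map M f \<rho> B" "\<rho> \<le> 1" and "compact M"
    and geo: "r > 0" "A \<ge> 0" "\<And>x y. x \<in> M \<Longrightarrow> y \<in> M \<Longrightarrow> dist x y < r \<Longrightarrow> near_geodesic M A x y"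
    and hyp: "only_hyperbolic_periodic_points M f" and "n \<ge> 1"
  shows "finite (periodic_points M f n)"
proof (rule ccontr)
  interpret C1_Holder_map M f \<rho> B by fact
  let ?P = "periodic_points M f n"
  assume "infinite ?P"
  moreover have "?P \<subseteq> M" by (auto simp: periodic_points_def)
  ultimately obtain p where p: "p \<in> M" "p islimpt ?P"
    using \<open>compact M\<close> compact_eq_Bolzano_Weierstrass by metis
  have "closed ?P"
  proof -
    have "continuous_on M (f ^^ n)"
      using iter_diff by (intro differentiable_imp_continuous_on) (simp add: differentiable_on_def)
    then have "closed (M \<inter> (\<lambda>x. (f ^^ n) x - x) -` {0})"
      using \<open>compact M\<close> by (intro continuous_closed_preimage continuous_intros compact_imp_closed) auto
    moreover have "?P = M \<inter> (\<lambda>x. (f ^^ n) x - x) -` {0}" by (auto simp: periodic_points_def)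
    ultimately show ?thesis by simp
  qed
  then have "p \<in> ?P" using p closed_limpt by blast
  obtain g where g: "g > 0" "ereal g \<le> gamma_point n M f p"
    using gamma_point_pos[OF fH(1) hyp \<open>n \<ge> 1\<close> \<open>p \<in> ?P\<close>] ereal_dense2
    by (metis ereal_less(2) less_imp_le)
  define K where "K = B ^ n * (B powr \<rho>) ^ n * (1 + A)\<^sup>2"
  have "K > 0" unfolding K_def using B_ge_1 \<open>A \<ge> 0\<close> by simp
  \<comment> \<open>The entry \<open>r\<close> provides the joining curve, the entry 1 allows
    \<open>1 + A * ?d\<close> to be replaced by \<open>1 + A\<close>, and the last entry solves
    \<open>K * e powr \<rho> = g\<close>.\<close>
  define e where "e = min r (min 1 ((g / K) powr (1 / \<rho>)))"
  have "e > 0" using \<open>K > 0\<close> g(1) geo(1) by (simp add: e_def)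
  then obtain y where y: "y \<in> ?P" "y \<noteq> p" "dist y p < e"
    using p(2) unfolding islimpt_approachable by blast
  let ?d = "dist p y"
  have d: "?d < r" "?d \<le> 1" "?d < (g / K) powr (1 / \<rho>)" using y(3) by (auto simp: e_def dist_commute)
  have "near_geodesic M A p y" using geo(3) p(1) y(1) d(1) by (simp add: periodic_points_def)
  then have "gamma_point n M f p \<le> ereal (B ^ n * (B powr \<rho>) ^ n * (1 + A * ?d)\<^sup>2 * ?d powr \<rho>)"
    using gamma_point_pair_le[OF fH _ geo(2) \<open>n \<ge> 1\<close> \<open>p \<in> ?P\<close> y(1)] y(2) by auto
  with g(2) have "g \<le> B ^ n * (B powr \<rho>) ^ n * (1 + A * ?d)\<^sup>2 * ?d powr \<rho>"
    using order_trans by fastforce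
  also have "\<dots> \<le> K * ?d powr \<rho>"
    unfolding K_def using B_ge_1 geo(2) d(2)
    by (intro mult_right_mono mult_left_mono power_mono) (auto simp: mult_left_le)
  also have "\<dots> < K * ((g / K) powr (1 / \<rho>)) powr \<rho>"
    using \<open>K > 0\<close> d(3) \<rho>_pos by (intro mult_strict_left_mono powr_less_mono2) auto
  also have "\<dots> = g" using \<open>K > 0\<close> \<rho>_pos g(1) by (simp add: powr_powr)
  finally show False by simp
qed

text \<open>Since \<open>B \<ge> 2 powr (1 / \<rho>)\<close>, the separation scale is automatically \<open>O(\<rho>)\<close>; this is what
  keeps the constant of the theorem independent of \<open>\<rho>\<close>.\<close>

lemma separation_scale_le:
  fixes B \<rho> g :: real
  assumes "0 < \<rho>" "\<rho> \<le> 1" "1 \<le> B" "2 \<le> B powr \<rho>" "n \<ge> 1" "0 < g" "g \<le> B ^ n + 1"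
  shows "(g / (B ^ n * (B powr \<rho>) ^ n)) powr (1 / \<rho>) \<le> 2 * exp 2 * \<rho>"
proof -
  have "exp (ln 2 / \<rho>) = 2 powr (1 / \<rho>)" by (simp add: powr_def)
  also have "\<dots> \<le> (B powr \<rho>) powr (1 / \<rho>)" using assms by (intro powr_mono2) auto
  also have "\<dots> = B" using assms by (simp add: powr_powr)
  also have "\<dots> \<le> B ^ n" using assms by (simp add: self_le_power)
  finally have "1 / (2 * \<rho>) \<le> B ^ n"
  proof -
    assume *: "exp (ln 2 / \<rho>) \<le> B ^ n"
    have "1 / (2 * \<rho>) \<le> ln 2 / \<rho>" using ln2_ge_two_thirds \<open>0 < \<rho>\<close> by (simp add: field_simps)
    also have "\<dots> \<le> exp (ln 2 / \<rho>)" using exp_ge_add_one_self[of "ln 2 / \<rho>"] by linarith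
    finally show ?thesis using * by simp
  qed
  \<comment> \<open>This bound enters twice: in
    \<open>g / B ^ n \<le> 1 + 2 * \<rho> \<le> exp (2 * \<rho>)\<close>, whose
    \<open>1 / \<rho>\<close>-th power is the constant \<open>exp 2\<close>, and in the remaining
    factor \<open>1 / B ^ n\<close>, which supplies the \<open>\<rho>\<close>.\<close>
  then have b: "1 / B ^ n \<le> 2 * \<rho>" using assms by (simp add: field_simps)
  have Bn: "B ^ n > 0" using assms by simp
  have "g / (B ^ n * (B powr \<rho>) ^ n) \<le> (1 + 1 / B ^ n) / (B powr \<rho>) ^ n"
  proof -
    have "g / B ^ n \<le> (B ^ n + 1) / B ^ n" using assms Bn by (intro divide_right_mono) auto
    also have "\<dots> = 1 + 1 / B ^ n" using Bn assms by (simp add: add_divide_distrib)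
    finally show ?thesis using assms by (simp add: divide_right_mono flip: divide_divide_eq_left)
  qed
  also have "\<dots> \<le> exp (2 * \<rho>) / (B powr \<rho>) ^ n"
    using order_trans[OF add_left_mono[OF b, of 1] exp_ge_add_one_self] assms
    by (intro divide_right_mono) auto
  finally have "(g / (B ^ n * (B powr \<rho>) ^ n)) powr (1 / \<rho>) \<le> (exp (2 * \<rho>) / (B powr \<rho>) ^ n) powr (1 / \<rho>)"
    using assms by (intro powr_mono2) auto
  also have "\<dots> = exp 2 / B ^ n"
  proof -
    have "((B powr \<rho>) ^ n) powr (1 / \<rho>) = B ^ n"
      using assms by (simp add: powr_powr flip: powr_realpow)
    then show ?thesis using assms by (simp add: powr_divide exp_powr_real)
  qed
  also have "\<dots> \<le> exp 2 * (2 * \<rho>)" using b by (simp add: divide_inverse)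
  finally show ?thesis by simp
qed


section \<open>Counting the separated periodic points\<close>

lemma gamma_min_pos:
  fixes M :: "(real ^ 'd) set"
  assumes fH: "C1_Holder_map M f \<rho> B" and hyp: "only_hyperbolic_periodic_points M f" and "n \<ge> 1"
    and fin: "finite (periodic_points M f n)"
  shows "gamma_min n M f > 0"
proof (cases "periodic_points M f n = {}")
  case True
  then show ?thesis by (simp add: gamma_min_def top_ereal_def)
next
  case False
  have "gamma_min n M f = Min (gamma_point n M f ` periodic_points M f n)"
    unfolding gamma_min_def using fin False by (intro cInf_eq_Min) auto
  moreover have "\<dots> \<in> gamma_point n M f ` periodic_points M f n"
    using fin False by (intro Min_in) auto
  ultimately show ?thesis using gamma_point_pos[OF fH hyp \<open>n \<ge> 1\<close>] by force
qed

text \<open>This serves dimension 0, where the packing bound is the same at every scale, so any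
  positive separation will do. Inserting 1 into \<open>D\<close> covers sets with at most one point
  and caps the scale.\<close>

lemma finite_separated:
  fixes P :: "'a::metric_space set"
  assumes "finite P"
  shows "\<exists>s. 0 < s \<and> s \<le> 1 \<and> (\<forall>x\<in>P. \<forall>y\<in>P. x \<noteq> y \<longrightarrow> s \<le> dist x y)"
proof -
  define D where "D = insert 1 ((\<lambda>(x, y). dist x y) ` {(x, y) \<in> P \<times> P. x \<noteq> y})"
  have "finite {(x, y) \<in> P \<times> P. x \<noteq> y}"
    by (rule finite_subset[of _ "P \<times> P"]) (use assms in auto)
  then have "finite D" unfolding D_def by simp
  moreover have "D \<noteq> {}" "\<And>d. d \<in> D \<Longrightarrow> d > 0" by (auto simp: D_def)
  moreover have "1 \<in> D" "\<And>x y. x \<in> P \<Longrightarrow> y \<in> P \<Longrightarrow> x \<noteq> y \<Longrightarrow> dist x y \<in> D" by (auto simp: D_def)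
  ultimately show ?thesis by (intro exI[of _ "Min D"]) (auto intro: Min_le)
qed

theorem proposition1p1:
  fixes M :: "(real ^ 'd) set" and N :: nat
  assumes "compact M" and "smooth_submanifold N M"
  shows "\<exists>C>0. \<forall>(\<rho>::real) (f :: real ^ 'd \<Rightarrow> real ^ 'd).
           0 < \<rho> \<longrightarrow> \<rho> \<le> 1 \<longrightarrow> C1_Holder_diffeo \<rho> M f \<longrightarrow>
           only_hyperbolic_periodic_points M f \<longrightarrow>
           (\<forall>n\<ge>1. finite (periodic_points M f n) \<and>
              real (card (periodic_points M f n))
                \<le> C * M_const \<rho> M f powr (real n * real N * (1 + \<rho>) / \<rho>)
                    * neg_powr (gamma_min n M f) (real N / \<rho>))"
proof -
  obtain r A where geo: "r > 0" "A \<ge> 0"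
    "\<And>x y. x \<in> M \<Longrightarrow> y \<in> M \<Longrightarrow> dist x y < r \<Longrightarrow> near_geodesic M A x y"
    using compact_submanifold_near_geodesic[OF assms] by blast
  obtain C0 where C0: "C0 > 0" "\<And>s E. 0 < s \<Longrightarrow> s \<le> 1 \<Longrightarrow> finite E \<Longrightarrow> E \<subseteq> M \<Longrightarrow>
      \<forall>x\<in>E. \<forall>y\<in>E. x \<noteq> y \<longrightarrow> s \<le> dist x y \<Longrightarrow> real (card E) \<le> C0 * (1 / s) ^ N"
    using compact_submanifold_separated_card[OF assms] by metis
  \<comment> \<open>\<open>E\<close> is the factor in \<open>separation_scale_le\<close>. The first
    two entries of \<open>c\<close> bring the separation scale below \<open>r\<close>, where curves
    exist, and below 1, as packing requires; the exponential compensates the distortion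
    \<open>(1 + A * d)\<^sup>2\<close>. All of them depend on \<open>M\<close> only.\<close>
  define E :: real where "E = 2 * exp 2"
  define c where "c = min (min (r / E) (1 / E)) (exp (- (2 * A * E)))"
  have "E > 0" "E \<ge> 1" using exp_ge_add_one_self[of 2] by (simp_all add: E_def)
  then have c: "c > 0" "c * E \<le> r" "c * E \<le> 1" "c \<le> exp (- (2 * A * E))"
  proof -
    show "c > 0" "c \<le> exp (- (2 * A * E))" using \<open>E > 0\<close> geo(1) by (simp_all add: c_def)
    have "c \<le> r / E" "c \<le> 1 / E" by (simp_all add: c_def)
    then show "c * E \<le> r" "c * E \<le> 1" using \<open>E > 0\<close> by (simp_all add: field_simps)
  qed
  have "c \<le> 1" using c(4) geo(2) \<open>E > 0\<close> by (simp add: order_trans)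
  have "finite (periodic_points M f n) \<and> real (card (periodic_points M f n))
      \<le> C0 * (1 / c) ^ N * M_const \<rho> M f powr (real n * real N * (1 + \<rho>) / \<rho>)
          * neg_powr (gamma_min n M f) (real N / \<rho>)"
    if \<rho>: "0 < \<rho>" "\<rho> \<le> 1" and f: "C1_Holder_diffeo \<rho> M f" and hyp: "only_hyperbolic_periodic_points M f"
      and n: "n \<ge> 1" for \<rho> f and n :: nat
  proof -
    define B where "B = M_const \<rho> M f"
    define P where "P = periodic_points M f n"
    define K where "K = B ^ n * (B powr \<rho>) ^ n"
    have fH: "C1_Holder_map M f \<rho> B"
      unfolding B_def using f \<rho>(1) assms submanifold_subspace_tangent_space
      by (intro C1_Holder_map_M_const) (auto simp: C1_Holder_diffeo_def bij_betw_def)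
    then interpret C1_Holder_map M f \<rho> B .
    have fin: "finite P" unfolding P_def
      by (rule finite_periodic_points[OF fH \<rho>(2) assms(1) geo hyp n])
    have PM: "P \<subseteq> M" by (auto simp: P_def periodic_points_def)
    have gpos: "gamma_min n M f > 0" using gamma_min_pos[OF fH hyp n] fin by (simp add: P_def)
    have "real (card P) \<le> C0 * (1 / c) ^ N * B powr (real n * real N * (1 + \<rho>) / \<rho>)
          * neg_powr (gamma_min n M f) (real N / \<rho>)"
    proof -
      consider "P = {}" | "N = 0" | "P \<noteq> {}" "N \<ge> 1" by linarith
      then show ?thesis
      proof cases
        case 1
        then show ?thesis using C0(1) c(1) by (simp add: neg_powr_def)
      next
        \<comment> \<open>In dimension 0 all exponents vanish, and \<open>neg_powr\<close> equals 1
          both at positive reals and at \<open>\<infinity>\<close>.\<close>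
        case 2
        have "neg_powr (gamma_min n M f) 0 = 1"
          using gpos by (cases "gamma_min n M f") (auto simp: neg_powr_def)
        moreover have "real (card P) \<le> C0"
          using finite_separated[OF fin] C0(2)[OF _ _ fin PM] 2 by fastforce
        ultimately show ?thesis using 2 B_ge_1 by simp
      next
        case 3
        then obtain x0 v where x0: "x0 \<in> P" and v: "v \<in> tangent_space M x0" "v \<noteq> 0"
          using submanifold_tangent_space_nontrivial[OF assms(2)] PM by blast
        have g_le: "gamma_min n M f \<le> gamma_point n M f x" if "x \<in> P" for x
          using that unfolding gamma_min_def P_def by (rule INF_lower)
        have "gamma_min n M f \<le> ereal (B ^ n + 1)"
          using g_le[OF x0] gamma_point_le[OF fH _ v] x0 PM order_trans by blast
        with gpos obtain g where g: "gamma_min n M f = ereal g" "0 < g" "g \<le> B ^ n + 1"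
          by (cases "gamma_min n M f") auto
        \<comment> \<open>This is the scale that the pair estimate would give without distortion: it
          solves \<open>K * T powr \<rho> = g\<close>.\<close>
        define T where "T = (g / K) powr (1 / \<rho>)"
        have "K > 0" using B_ge_1 by (simp add: K_def)
        have T: "T > 0" "T \<le> E * \<rho>"
          using separation_scale_le[OF \<rho> B_ge_1 B_powr n g(2,3)] \<open>K > 0\<close> g(2)
          by (simp_all add: T_def E_def flip: K_def)
        have cT: "c * T \<le> c * E * \<rho>" using T(2) c(1) by simp
        have "c * E * \<rho> \<le> c * E" using \<rho> c(1) \<open>E > 0\<close> by (simp add: mult_left_le)
        with cT c(2,3) have cT': "c * T \<le> r" "c * T \<le> 1" by linarith+
        have sep: "c * T \<le> dist x y" if xy: "x \<in> P" "y \<in> P" "x \<noteq> y" for x y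
        proof (rule ccontr)
          let ?d = "dist x y"
          assume "\<not> c * T \<le> dist x y"
          then have d: "?d < c * T" by simp
          then have ng: "near_geodesic M A x y" using xy PM cT'(1) by (intro geo(3)) auto
          have "ereal g \<le> ereal (K * (1 + A * ?d)\<^sup>2 * ?d powr \<rho>)"
            using g_le[OF xy(1)] gamma_point_pair_le[OF fH \<rho>(2) ng geo(2) n] xy
            unfolding g(1) P_def K_def using order_trans by blast
          then have "g \<le> K * (1 + A * ?d)\<^sup>2 * ?d powr \<rho>" by simp
          also have "\<dots> < K * (1 + A * ?d)\<^sup>2 * (c * T) powr \<rho>"
            using d \<rho> \<open>K > 0\<close> geo(2)
            by (intro mult_strict_left_mono powr_less_mono2 mult_pos_pos zero_less_power add_pos_nonneg) auto
          also have "(c * T) powr \<rho> = c powr \<rho> * (g / K)"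
            using c(1) T(1) \<rho> g(2) \<open>K > 0\<close> by (simp add: powr_mult T_def powr_powr)
          also have "K * (1 + A * ?d)\<^sup>2 * (c powr \<rho> * (g / K)) = g * ((1 + A * ?d)\<^sup>2 * c powr \<rho>)"
            using \<open>K > 0\<close> by simp
          finally have "1 < (1 + A * ?d)\<^sup>2 * c powr \<rho>" using g(2) by simp
          \<comment> \<open>Here \<open>?d \<le> E * \<rho>\<close> is decisive: the distortion is
            at most \<open>exp (2 * A * E * \<rho>)\<close>, which is exactly what the factor
            \<open>c powr \<rho>\<close> cancels, for every \<open>\<rho>\<close> at once.\<close>
          also have "\<dots> \<le> (exp (A * (E * \<rho>)))\<^sup>2 * exp (- (2 * A * E)) powr \<rho>"
          proof (intro mult_mono power_mono powr_mono2)
            have "c * (E * \<rho>) \<le> 1 * (E * \<rho>)"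
              using \<open>c \<le> 1\<close> \<open>E > 0\<close> \<rho>(1) by (intro mult_right_mono) auto
            then have "?d \<le> E * \<rho>" using d cT by (simp add: mult.assoc)
            then have "1 + A * ?d \<le> 1 + A * (E * \<rho>)" using geo(2) by (simp add: mult_left_mono)
            also have "\<dots> \<le> exp (A * (E * \<rho>))" by (rule exp_ge_add_one_self)
            finally show "1 + A * ?d \<le> exp (A * (E * \<rho>))" .
          qed (use c geo(2) \<rho> in auto)
          also have "\<dots> = 1"
            by (simp add: exp_powr_real power2_eq_square flip: exp_add)
          finally show False by simp
        qed
        have "real (card P) \<le> C0 * (1 / (c * T)) ^ N"
          using sep by (intro C0(2) fin PM) (use c(1) T(1) cT' in auto)
        also have "\<dots> = C0 * (1 / c) ^ N * (1 / T) ^ N"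
          by (simp add: power_divide power_mult_distrib)
        also have "(1 / T) ^ N = B powr (real n * real N * (1 + \<rho>) / \<rho>) * neg_powr (gamma_min n M f) (real N / \<rho>)"
        proof -
          have KB: "K = B powr (real n * (1 + \<rho>))"
            unfolding K_def using B_ge_1
            by (simp add: powr_add powr_powr distrib_left mult.commute flip: powr_realpow)
          have "(1 / T) ^ N = (1 / T) powr real N" using T(1) by (simp add: powr_realpow)
          also have "\<dots> = ((K / g) powr (1 / \<rho>)) powr real N"
            using \<open>K > 0\<close> g(2) by (simp add: T_def powr_divide)
          also have "\<dots> = (K / g) powr (real N / \<rho>)" by (simp add: powr_powr)
          also have "\<dots> = K powr (real N / \<rho>) * g powr (- (real N / \<rho>))"
            using \<open>K > 0\<close> g(2) by (simp add: powr_divide powr_minus_divide)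
          finally show ?thesis using g by (simp add: KB powr_powr neg_powr_def mult_ac)
        qed
        finally show ?thesis by (simp add: mult_ac)
      qed
    qed
    then show ?thesis using fin by (simp add: P_def B_def)
  qed
  moreover have "C0 * (1 / c) ^ N > 0" using C0(1) c(1) by simp
  ultimately show ?thesis by blast
qed

end
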